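(* Suppose $\mu>0$. For any $\epsilon>0$, run R-Catalyst(SGD) (defined in the context) from $x_{(0)}$ for a total of $E=\log_2\left(\frac{f(x_{(0)})-f(x^* )}{\epsilon}\right)$ epochs. The $e$-th epoch corresponds to running Catalyst(SGD), initialized at $x_{(e-1)}$, with parameters $$K=6\sqrt{\frac L\mu},\quad\gamma_k=\frac2{k+1},\quad\beta_k=\frac{(k+1)L}{k},\quad\alpha_k=\frac{\beta_k}{1-\Lambda_T},$$ where $$T=8+\frac{128\,\sigma^2\,2^eK}{L\,(f(x_{(0)})-f(x^* ))},\qquad\Lambda_T=\frac{90}{(T+9)(T+10)}.$$ In addition, at the $k$-th iteration of the $e$-th epoch, the proximal step $\min_{u\in X}\phi_k(u)$ is solved by running SGD$(\phi_k)$ (for $T$ steps) with $\eta_t=\frac{2}{\beta_k(t+8)}$. Then $$\mathbb E[f(\tilde x_K)-f(x^* )]\le\epsilon ,$$ where $\tilde x_K=x_{(E)}$ is the output of the last epoch. In addition, the number of calls to the stochastic first-order oracle is bounded by $$\mathcal O\left(\sqrt{\frac L\mu}\,\log_2\!\left(\frac{f(x_{(0)})-f(x^* )}{\epsilon}\right)+\frac{\sigma^2}{\mu\epsilon}\right).$$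
   Context: Setting: $\|\cdot\|$ is a norm and $\|\cdot\|_*$ its dual norm. $X\subseteq\mathbb R^d$ is a closed convex set and $f:X\to\mathbb R$ is a differentiable convex function such that, for some $\mu\ge0$, $f(\gamma x_1+(1-\gamma)x_2)\le\gamma f(x_1)+(1-\gamma)f(x_2)-\frac{\mu\gamma(1-\gamma)}{2}\|x_1-x_2\|^2$ for all $x_1,x_2\in X$ (and $\gamma\in[0,1]$), and $f$ is smooth with modulus $L$: $|f(x_2)-f(x_1)-\langle\nabla f(x_1),x_2-x_1\rangle|\le\frac L2\|x_1-x_2\|^2$ for all $x_1,x_2\in X$. The problem is $\min_{x\in X}f(x)$, and $x^*$ denotes its minimizer. Stochastic first-order oracle (SFO): a call at $x$ with random sample $\xi$ outputs $\nabla f(x;\xi)$ with $\mathbb E_\xi[\nabla f(x;\xi)]=\nabla f(x)$ and $\mathbb E_\xi\|\nabla f(x;\xi)-\nabla f(x)\|_*^2\le\sigma^2$. Catalyst(SGD): given $\bar x_0=\tilde x_0$, for $k=1,\dots,K$: (i) $\hat x_k=\gamma_k\bar x_{k-1}+(1-\gamma_k)\tilde x_{k-1}$; (ii) with $\phi_k(u)=f(u)+\frac{\beta_k}{2}\|u-\hat x_k\|^2$, let $(\tilde x_k,x_k)=(\bar u_T,u_T)$ be the output of SGD$(\phi_k)$; (iii) $\bar x_k=\frac{1}{\alpha_k\gamma_k+\mu(1-\gamma_k)}\left[\alpha_kx_k+(\mu-\alpha_k)(1-\gamma_k)\tilde x_{k-1}\right]$. The output is $\tilde x_K$. SGD$(\phi_k)$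 with stepsizes $\{\eta_t\}$ and $T$ steps: $u_0=\hat x_k$; for $t=1,\dots,T$, $g_{t-1}=\nabla f(u_{t-1};\xi_{t-1})+\beta_k(u_{t-1}-\hat x_k)$, where $\nabla f(u_{t-1};\xi_{t-1})$ is an SFO output, and $u_t=\arg\min_{u\in X}\{\langle g_{t-1},u\rangle+\frac1{2\eta_t}\|u-u_{t-1}\|^2\}$. It outputs $u_T$ and the average $\bar u_T=\frac{\Lambda_T}{1-\Lambda_T}\sum_{t=1}^T\frac{\eta_t\mu_\phi}{\Lambda_t}u_t$, where in this average $\Lambda_0=1$, $\Lambda_t=(1-\eta_t\mu_\phi)\Lambda_{t-1}$ for $t\ge1$, and $\mu_\phi$ is the strong-convexity modulus of $\phi_k$ (taken to be $\beta_k$). The parameter $\alpha_k$ uses the value of $\Lambda_T$ displayed in the claim. R-Catalyst(SGD): for $e=1,\dots,E$, $x_{(e)}$ is the output of Catalyst(SGD) started from $x_{(e-1)}$ and run for $K$ iterations.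
   Formalization: The norm is taken Euclidean (β_k(u−x̂_k) must be the proximal gradient); f and SFO assumptions hold on a convex Y⊇X containing all centers x̂_k, which can leave X; E, K, T are rounded up and the log factor is max(1, log₂(·)), since a full epoch may be run when the log is near 0. *)

theory Defs
  imports "HOL-Probability.Probability"
begin

text \<open>
  The space is an abstract Euclidean space, so \<open>norm\<close> is the norm of an inner product.
  SGD on \<open>\<phi>(u) = f(u) + \<beta>/2 (norm (u - c))\<^sup>2\<close> uses \<open>\<beta> (u - c)\<close> as the gradient of the
  proximal term; the following lemma shows that this leaves no other choice of norm.
\<close>

lemma norm_with_identity_gradient:
  fixes N :: "'a::euclidean_space \<Rightarrow> real"
  assumes nonneg: "\<And>x. 0 \<le> N x"
    and hom: "\<And>a x. N (a *\<^sub>R x) = \<bar>a\<bar> * N x"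
    and grad: "\<And>x. ((\<lambda>u. (N u)\<^sup>2 / 2) has_derivative (\<lambda>h. x \<bullet> h)) (at x)"
  shows "N x = norm x"
proof -
  have "((\<lambda>u. (N u)\<^sup>2 / 2) has_derivative (\<lambda>h. x \<bullet> h)) (at ((1::real) *\<^sub>R x))"
    using grad[of x] by simp
  then have "((\<lambda>a::real. (N (a *\<^sub>R x))\<^sup>2 / 2) has_derivative (\<lambda>a. x \<bullet> (a *\<^sub>R x))) (at 1)"
    by (rule has_derivative_compose[of "\<lambda>a. a *\<^sub>R x", rotated])
      (auto intro!: derivative_eq_intros)
  then have "((\<lambda>a::real. a\<^sup>2 * (N x)\<^sup>2 / 2) has_real_derivative (x \<bullet> x)) (at 1)"
    by (simp add: hom power_mult_distrib has_field_derivative_def mult_commute_abs)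
  moreover have "((\<lambda>a::real. a\<^sup>2 * (N x)\<^sup>2 / 2) has_real_derivative (N x)\<^sup>2) (at 1)"
    by (auto intro!: derivative_eq_intros)
  ultimately have "(N x)\<^sup>2 = x \<bullet> x"
    using DERIV_unique by blast
  then show ?thesis
    using nonneg[of x] by (simp add: norm_eq_sqrt_inner real_sqrt_unique)
qed

abbreviation dual_norm :: "'a::euclidean_space \<Rightarrow> real"
  where "dual_norm y \<equiv> onorm (\<lambda>x. y \<bullet> x)"

definition strongly_convex_on :: "'a::euclidean_space set \<Rightarrow> real \<Rightarrow> ('a \<Rightarrow> real) \<Rightarrow> bool"
  where "strongly_convex_on Y \<mu> f \<longleftrightarrow>
    (\<forall>x\<^sub>1\<in>Y. \<forall>x\<^sub>2\<in>Y. \<forall>\<gamma>\<in>{0..1}.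
      f (\<gamma> *\<^sub>R x\<^sub>1 + (1 - \<gamma>) *\<^sub>R x\<^sub>2)
        \<le> \<gamma> * f x\<^sub>1 + (1 - \<gamma>) * f x\<^sub>2 - \<mu> * \<gamma> * (1 - \<gamma>) / 2 * (norm (x\<^sub>1 - x\<^sub>2))\<^sup>2)"

definition gradient_on :: "'a::euclidean_space set \<Rightarrow> ('a \<Rightarrow> real) \<Rightarrow> ('a \<Rightarrow> 'a) \<Rightarrow> bool"
  where "gradient_on Y f grad_f \<longleftrightarrow>
    (\<forall>x\<in>Y. (f has_derivative (\<lambda>h. grad_f x \<bullet> h)) (at x within Y))"

definition smooth_modulus_on ::
    "'a::euclidean_space set \<Rightarrow> real \<Rightarrow> ('a \<Rightarrow> real) \<Rightarrow> ('a \<Rightarrow> 'a) \<Rightarrow> bool"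
  where "smooth_modulus_on Y L f grad_f \<longleftrightarrow>
    (\<forall>x\<^sub>1\<in>Y. \<forall>x\<^sub>2\<in>Y.
      \<bar>f x\<^sub>2 - f x\<^sub>1 - grad_f x\<^sub>1 \<bullet> (x\<^sub>2 - x\<^sub>1)\<bar> \<le> L / 2 * (norm (x\<^sub>1 - x\<^sub>2))\<^sup>2)"

text \<open>
  The oracle output \<open>\<nabla>f(x; \<xi>)\<close> is \<open>G x \<xi>\<close> with \<open>\<xi>\<close> distributed as \<open>P\<close>.  Joint measurability makes
  oracle calls at random points random variables.  Integrability is explicit because
  the Bochner integral of a non-integrable function is 0.
\<close>

definition stochastic_oracle ::
    "'a::euclidean_space set \<Rightarrow> ('a \<Rightarrow> 'a) \<Rightarrow> real \<Rightarrow> 's measure \<Rightarrow> ('a \<Rightarrow> 's \<Rightarrow> 'a) \<Rightarrow> bool"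
  where "stochastic_oracle Y grad_f \<sigma> P G \<longleftrightarrow>
    prob_space P \<and>
    (\<lambda>(x, s). G x s) \<in> borel_measurable (restrict_space borel Y \<Otimes>\<^sub>M P) \<and>
    (\<forall>x\<in>Y. integrable P (G x) \<and> (\<integral>s. G x s \<partial>P) = grad_f x \<and>
      integrable P (\<lambda>s. (dual_norm (G x s - grad_f x))\<^sup>2) \<and>
      (\<integral>s. (dual_norm (G x s - grad_f x))\<^sup>2 \<partial>P) \<le> \<sigma>\<^sup>2)"

definition iid_samples :: "'w measure \<Rightarrow> 's measure \<Rightarrow> (nat \<Rightarrow> 'w \<Rightarrow> 's) \<Rightarrow> bool"
  where "iid_samples M P \<xi> \<longleftrightarrow>
    prob_space M \<and> prob_space.indep_vars M (\<lambda>_. P) \<xi> UNIV \<and> (\<forall>n. distr M P (\<xi> n) = P)"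

text \<open>
  The set \<open>Y \<supseteq> X\<close> is the region on which \<open>f\<close> is defined and may be queried.  It is there because
  the proximal centers, which are the starting points of SGD, are extrapolated and can lie
  outside \<open>X\<close>.
\<close>

definition problem_setting ::
    "'a::euclidean_space set \<Rightarrow> 'a set \<Rightarrow> ('a \<Rightarrow> real) \<Rightarrow> ('a \<Rightarrow> 'a) \<Rightarrow> real \<Rightarrow> real \<Rightarrow> real
      \<Rightarrow> 's measure \<Rightarrow> ('a \<Rightarrow> 's \<Rightarrow> 'a) \<Rightarrow> bool"
  where "problem_setting X Y f grad_f \<mu> L \<sigma> P G \<longleftrightarrow>
    closed X \<and> convex X \<and> X \<subseteq> Y \<and> convex Y \<and>
    convex_on Y f \<and> gradient_on Y f grad_f \<and>
    strongly_convex_on Y \<mu> f \<and> smooth_modulus_on Y L f grad_f \<and>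
    stochastic_oracle Y grad_f \<sigma> P G"

text \<open>
  The algorithms are deterministic functions of the stream \<open>s\<close> of samples.  Each state
  carries the number of oracle calls made so far, which is also the index of the next
  unused sample.
\<close>

context
  fixes X :: "'a::euclidean_space set" and G :: "'a \<Rightarrow> 's \<Rightarrow> 'a" and s :: "nat \<Rightarrow> 's"
begin

primrec sgd :: "real \<Rightarrow> 'a \<Rightarrow> (nat \<Rightarrow> real) \<Rightarrow> nat \<Rightarrow> nat \<Rightarrow> 'a \<times> nat"
  where
    "sgd \<beta> c \<eta> n 0 = (c, n)"
  | "sgd \<beta> c \<eta> n (Suc t) =
      (let (u, m) = sgd \<beta> c \<eta> n t;
           g = G u (s m) + \<beta> *\<^sub>R (u - c)
       in (arg_min_on (\<lambda>v. g \<bullet> v + 1 / (2 * \<eta> (Suc t)) * (norm (v - u))\<^sup>2) X, Suc m))"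

primrec sgd_Lambda :: "real \<Rightarrow> (nat \<Rightarrow> real) \<Rightarrow> nat \<Rightarrow> real"
  where
    "sgd_Lambda \<mu>\<^sub>\<phi> \<eta> 0 = 1"
  | "sgd_Lambda \<mu>\<^sub>\<phi> \<eta> (Suc t) = (1 - \<eta> (Suc t) * \<mu>\<^sub>\<phi>) * sgd_Lambda \<mu>\<^sub>\<phi> \<eta> t"

text \<open>
  With the step sizes \<open>2 / (\<beta> (t + 8))\<close> this recursion gives \<open>56 / ((t + 7) (t + 8))\<close>.  It
  determines only the weights of the average; the number \<open>90 / ((T + 9) (T + 10))\<close>, which
  enters the parameter \<open>\<alpha>\<close>, is a different one.
\<close>

definition sgd_average :: "real \<Rightarrow> 'a \<Rightarrow> (nat \<Rightarrow> real) \<Rightarrow> nat \<Rightarrow> nat \<Rightarrow> 'a"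
  where "sgd_average \<beta> c \<eta> n T =
    (sgd_Lambda \<beta> \<eta> T / (1 - sgd_Lambda \<beta> \<eta> T)) *\<^sub>R
      (\<Sum>t=1..T. (\<eta> t * \<beta> / sgd_Lambda \<beta> \<eta> t) *\<^sub>R fst (sgd \<beta> c \<eta> n t))"

definition prox_center :: "(nat \<Rightarrow> real) \<Rightarrow> nat \<Rightarrow> 'a \<Rightarrow> 'a \<Rightarrow> 'a"
  where "prox_center \<gamma> k x_bar x_tilde = \<gamma> k *\<^sub>R x_bar + (1 - \<gamma> k) *\<^sub>R x_tilde"

text \<open>
  The state after \<open>k\<close> iterations is \<open>(x_bar\<^sub>k, x_tilde\<^sub>k, calls)\<close>; \<open>\<eta> k t\<close> is the step size of the
  \<open>t\<close>-th SGD step in iteration \<open>k\<close>.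
\<close>

primrec catalyst ::
    "real \<Rightarrow> (nat \<Rightarrow> real) \<Rightarrow> (nat \<Rightarrow> real) \<Rightarrow> (nat \<Rightarrow> nat \<Rightarrow> real) \<Rightarrow> (nat \<Rightarrow> real) \<Rightarrow> nat
      \<Rightarrow> 'a \<Rightarrow> nat \<Rightarrow> nat \<Rightarrow> 'a \<times> 'a \<times> nat"
  where
    "catalyst \<mu> \<gamma> \<beta> \<eta> \<alpha> T x n 0 = (x, x, n)"
  | "catalyst \<mu> \<gamma> \<beta> \<eta> \<alpha> T x n (Suc j) =
      (let k = Suc j;
           (x_bar, x_tilde, m) = catalyst \<mu> \<gamma> \<beta> \<eta> \<alpha> T x n j;
           c = prox_center \<gamma> k x_bar x_tilde;
           (u, m') = sgd (\<beta> k) c (\<eta> k) m T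
       in ((1 / (\<alpha> k * \<gamma> k + \<mu> * (1 - \<gamma> k))) *\<^sub>R
             (\<alpha> k *\<^sub>R u + ((\<mu> - \<alpha> k) * (1 - \<gamma> k)) *\<^sub>R x_tilde),
           sgd_average (\<beta> k) c (\<eta> k) m T,
           m'))"

text \<open>In the \<open>e\<close>-th epoch the parameters are \<open>\<alpha> e\<close> and \<open>T e\<close>.\<close>

primrec r_catalyst ::
    "real \<Rightarrow> (nat \<Rightarrow> real) \<Rightarrow> (nat \<Rightarrow> real) \<Rightarrow> (nat \<Rightarrow> nat \<Rightarrow> real) \<Rightarrow> (nat \<Rightarrow> nat \<Rightarrow> real)
      \<Rightarrow> (nat \<Rightarrow> nat) \<Rightarrow> nat \<Rightarrow> 'a \<Rightarrow> nat \<Rightarrow> 'a \<times> nat"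
  where
    "r_catalyst \<mu> \<gamma> \<beta> \<eta> \<alpha> T K x\<^sub>0 0 = (x\<^sub>0, 0)"
  | "r_catalyst \<mu> \<gamma> \<beta> \<eta> \<alpha> T K x\<^sub>0 (Suc i) =
      (let e = Suc i;
           (x, n) = r_catalyst \<mu> \<gamma> \<beta> \<eta> \<alpha> T K x\<^sub>0 i;
           (_, x_tilde, n') = catalyst \<mu> \<gamma> \<beta> \<eta> (\<alpha> e) (T e) x n K
       in (x_tilde, n'))"

definition r_catalyst_center ::
    "real \<Rightarrow> (nat \<Rightarrow> real) \<Rightarrow> (nat \<Rightarrow> real) \<Rightarrow> (nat \<Rightarrow> nat \<Rightarrow> real) \<Rightarrow> (nat \<Rightarrow> nat \<Rightarrow> real)
      \<Rightarrow> (nat \<Rightarrow> nat) \<Rightarrow> nat \<Rightarrow> 'a \<Rightarrow> nat \<Rightarrow> nat \<Rightarrow> 'a"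
  where "r_catalyst_center \<mu> \<gamma> \<beta> \<eta> \<alpha> T K x\<^sub>0 e k =
    (let (x, n) = r_catalyst \<mu> \<gamma> \<beta> \<eta> \<alpha> T K x\<^sub>0 (e - 1);
         (x_bar, x_tilde, _) = catalyst \<mu> \<gamma> \<beta> \<eta> (\<alpha> e) (T e) x n (k - 1)
     in prox_center \<gamma> k x_bar x_tilde)"

end

end

theory Submission
  imports Defs
begin

text \<open>
  Along a single sample path, the one-step energy inequality of SGD, with the oracle error kept as a
  perturbation, telescopes over the inner loop and then, through the averaging step of Catalyst, over
  the outer loop: with \<open>\<kappa> = 1 / (1 - \<Lambda>\<^sub>T)\<close>, the potential
  \<open>k (k + 1) / 2 (f x_tilde\<^sub>k - f x_opt) + \<kappa> L (norm (x_opt - x_bar\<^sub>k))\<^sup>2\<close> increases only by weighted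
  noise terms.  All reference points depend only on past samples, so in expectation the linear noise
  terms vanish and the quadratic ones are at most \<open>\<sigma>\<^sup>2\<close>.  Quadratic growth bounds the initial distance
  by the initial gap, so that with \<open>K \<ge> 6 sqrt (L / \<mu>)\<close> every epoch halves the expected gap.
\<close>

subsection \<open>Deterministic analysis\<close>

text \<open>The proximal centers are extrapolated and may leave \<open>X\<close>, so optimality of
  \<open>x_opt\<close> says nothing about \<open>f\<close> at the point where SGD starts; the
  initial state therefore enters each estimate only through a distance. SGD is compared not with
  \<open>x_opt\<close> but with \<open>anchor\<close>, a convex combination of \<open>x_opt\<close>
  and \<open>x_tilde\<close>: its difference from the center is \<gamma> times x_opt - x_bar, so
  \<open>x_tilde\<close> cancels and the squared distance gains the factor \<gamma>^2. Two facts
  make the outer sum telescope. The SGD bound carries the same coefficient \<kappa> \<beta> / 2 on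
  the first and the last distance, and the weight k (k + 1) / 2 turns \<beta> \<gamma>^2 into the
  constant 2 L while turning 1 - \<gamma> into the previous weight. Conditional expectations are
  avoided: a variable determined by the past and a fresh sample have a product law, so Fubini
  averages over the sample with the past frozen. Integrability has to be proved along with this, by
  an induction over all inner and outer steps.\<close>

lemma nonpos_if_le_all_multiples:
  fixes A B :: real
  assumes "\<And>c. 0 < c \<Longrightarrow> c < 1 \<Longrightarrow> A \<le> c * B"
  shows "A \<le> 0"
proof (rule tendsto_lowerbound)
  show "((\<lambda>c. c * B) \<longlongrightarrow> 0) (at_right 0)"
    by (auto intro!: tendsto_eq_intros)
  show "\<forall>\<^sub>F c in at_right 0. A \<le> c * B"
    using eventually_at_right_real[OF zero_less_one] by eventually_elim (use assms in auto)
  show "at_right (0::real) \<noteq> bot"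
    by simp
qed

lemma power2_norm_diff:
  fixes x y :: "'a::real_inner"
  shows "(norm (x - y))\<^sup>2 = (norm x)\<^sup>2 - 2 * (x \<bullet> y) + (norm y)\<^sup>2"
  by (simp add: power2_norm_eq_inner inner_diff inner_commute algebra_simps)

lemma power2_norm_add:
  fixes x y :: "'a::real_inner"
  shows "(norm (x + y))\<^sup>2 = (norm x)\<^sup>2 + 2 * (x \<bullet> y) + (norm y)\<^sup>2"
  by (simp add: power2_norm_eq_inner inner_add inner_commute algebra_simps)

lemma inner_le_power2_norm:
  fixes x y :: "'a::real_inner"
  assumes "0 < a"
  shows "x \<bullet> y \<le> (norm x)\<^sup>2 / (2 * a) + a / 2 * (norm y)\<^sup>2"
proof -
  have "0 \<le> (norm (x - a *\<^sub>R y))\<^sup>2"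
    by simp
  also have "\<dots> = (norm x)\<^sup>2 - 2 * a * (x \<bullet> y) + a\<^sup>2 * (norm y)\<^sup>2"
    by (simp add: power2_norm_diff power_mult_distrib)
  finally show ?thesis
    using assms by (simp add: field_simps power2_eq_square)
qed

text \<open>Completing the square: up to a constant the objective is the squared distance to u -
  \<eta> g, divided by 2 \<eta>. This identifies the choice made by \<open>arg_min_on\<close> with a
  projection, which is continuous and hence measurable.\<close>

lemma prox_step_eq_closest_point:
  fixes X :: "'a::euclidean_space set"
  assumes "closed X" "convex X" "X \<noteq> {}" "0 < \<eta>"
  shows "arg_min_on (\<lambda>v. g \<bullet> v + 1 / (2 * \<eta>) * (norm (v - u))\<^sup>2) X = closest_point X (u - \<eta> *\<^sub>R g)"
proof -
  let ?h = "\<lambda>v. g \<bullet> v + 1 / (2 * \<eta>) * (norm (v - u))\<^sup>2"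
  let ?p = "u - \<eta> *\<^sub>R g"
  have "?h v = (dist ?p v)\<^sup>2 / (2 * \<eta>) + (g \<bullet> u - \<eta> / 2 * (norm g)\<^sup>2)" for v
  proof -
    have "(dist ?p v)\<^sup>2 = (norm (v - u + \<eta> *\<^sub>R g))\<^sup>2"
      by (simp add: dist_commute dist_norm algebra_simps)
    also have "\<dots> = (norm (v - u))\<^sup>2 + 2 * \<eta> * (g \<bullet> v - g \<bullet> u) + \<eta>\<^sup>2 * (norm g)\<^sup>2"
      by (simp add: power2_norm_add power_mult_distrib inner_diff inner_commute)
    finally have "(dist ?p v)\<^sup>2 / (2 * \<eta>)
        = ((norm (v - u))\<^sup>2 + 2 * \<eta> * (g \<bullet> v - g \<bullet> u) + \<eta>\<^sup>2 * (norm g)\<^sup>2) / (2 * \<eta>)"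
      by simp
    also have "\<dots> = (norm (v - u))\<^sup>2 / (2 * \<eta>) + (g \<bullet> v - g \<bullet> u) + \<eta> / 2 * (norm g)\<^sup>2"
      using assms(4) by (simp add: add_divide_distrib power2_eq_square)
    finally show ?thesis by simp
  qed
  then have h_le: "?h v \<le> ?h w \<longleftrightarrow> dist ?p v \<le> dist ?p w" for v w
    using assms(4) by (simp add: divide_le_cancel)
  have "is_arg_min ?h (\<lambda>v. v \<in> X) (closest_point X ?p)"
    using closest_point_exists[OF assms(1,3), of ?p] h_le by (auto simp: is_arg_min_linorder)
  \<comment> \<open>\<open>arg_min_on\<close> is a Hilbert choice, so a minimizer must be exhibited
    before anything is known about it; uniqueness of the projection then identifies the chosen
    one.\<close>
  then have "is_arg_min ?h (\<lambda>v. v \<in> X) (arg_min_on ?h X)"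
    unfolding arg_min_on_def arg_min_def by (rule someI)
  then show ?thesis
    using closest_point_unique[OF assms(2,1)] h_le by (simp add: is_arg_min_linorder)
qed

text \<open>The obtuse angle property of the projection, with the inner product of v - u and v - x
  expanded into squared distances.\<close>

lemma closest_point_three_point:
  fixes X :: "'a::euclidean_space set" and u g :: 'a and \<eta> :: real
  assumes "closed X" "convex X" "x \<in> X"
  defines "v \<equiv> closest_point X (u - \<eta> *\<^sub>R g)"
  shows "2 * \<eta> * (g \<bullet> (v - x)) \<le> (norm (x - u))\<^sup>2 - (norm (x - v))\<^sup>2 - (norm (v - u))\<^sup>2"
proof -
  have "(u - \<eta> *\<^sub>R g - v) \<bullet> (x - v) \<le> 0"
    unfolding v_def by (intro closest_point_dot assms)
  then show ?thesis
    by (simp add: power2_norm_eq_inner inner_diff inner_commute algebra_simps)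
qed

text \<open>The oracle \<open>G\<close> enters as an arbitrary function, so everything proved here
  holds for every stream of samples; its statistics come in with
  \<open>stochastic_problem\<close>.\<close>

locale smooth_strongly_convex_problem =
  fixes X Y :: "'a::euclidean_space set" and f :: "'a \<Rightarrow> real" and grad_f :: "'a \<Rightarrow> 'a"
    and \<mu> L :: real and x_opt :: 'a
    and G :: "'a \<Rightarrow> 's \<Rightarrow> 'a"
  assumes closed_X: "closed X" and convex_X: "convex X" and X_subset_Y: "X \<subseteq> Y"
    and convex_Y: "convex Y" and convex_f: "convex_on Y f"
    and sc: "strongly_convex_on Y \<mu> f" and smooth: "smooth_modulus_on Y L f grad_f"
    and mu_pos: "0 < \<mu>" and L_pos: "0 < L"
    and opt: "is_arg_min f (\<lambda>x. x \<in> X) x_opt"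
begin

lemma opt_in_X: "x_opt \<in> X"
  using opt by (simp add: is_arg_min_linorder)

lemma opt_le: "x \<in> X \<Longrightarrow> f x_opt \<le> f x"
  using opt by (simp add: is_arg_min_linorder)

lemma in_Y: "x \<in> X \<Longrightarrow> x \<in> Y"
  using X_subset_Y by blast

lemma strongly_convexD:
  assumes "x \<in> Y" "y \<in> Y" "0 \<le> c" "c \<le> 1"
  shows "f (c *\<^sub>R x + (1 - c) *\<^sub>R y)
    \<le> c * f x + (1 - c) * f y - \<mu> * c * (1 - c) / 2 * (norm (x - y))\<^sup>2"
  using sc assms by (auto simp: strongly_convex_on_def)

lemma smoothD:
  assumes "x \<in> Y" "y \<in> Y"
  shows "\<bar>f y - f x - grad_f x \<bullet> (y - x)\<bar> \<le> L / 2 * (norm (y - x))\<^sup>2"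
  using smooth assms by (metis norm_minus_commute smooth_modulus_on_def)

text \<open>On the segment from u to x, smoothness at u bounds \<open>f\<close> from below and
  strong convexity bounds it from above. The quadratic errors at c x + (1 - c) u are of order c^2,
  so dividing by c and letting c tend to 0 leaves the claim.\<close>

lemma gradient_lower_bound:
  assumes "x \<in> Y" "u \<in> Y"
  shows "f u + grad_f u \<bullet> (x - u) + \<mu> / 2 * (norm (x - u))\<^sup>2 \<le> f x"
proof -
  let ?d = "(norm (x - u))\<^sup>2"
  have "grad_f u \<bullet> (x - u) + \<mu> / 2 * ?d - (f x - f u) \<le> c * ((L + \<mu>) / 2 * ?d)"
    if c: "0 < c" "c < 1" for c
  proof -
    let ?z = "c *\<^sub>R x + (1 - c) *\<^sub>R u"
    have z: "?z \<in> Y"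
      using convexD[OF convex_Y assms, of c "1 - c"] c by simp
    have zu: "?z - u = c *\<^sub>R (x - u)"
      by (simp add: algebra_simps)
    have "f u + grad_f u \<bullet> (?z - u) - L / 2 * (norm (?z - u))\<^sup>2 \<le> f ?z"
      using smoothD[OF assms(2) z] by linarith
    then have "f u + c * (grad_f u \<bullet> (x - u)) - L / 2 * (c\<^sup>2 * ?d) \<le> f ?z"
      unfolding zu by (simp add: power_mult_distrib)
    also have "\<dots> \<le> c * f x + (1 - c) * f u - \<mu> * c * (1 - c) / 2 * ?d"
      using strongly_convexD[OF assms, of c] c by simp
    finally have "c * (grad_f u \<bullet> (x - u) + \<mu> / 2 * ?d - (f x - f u)) \<le> c * (c * ((L + \<mu>) / 2 * ?d))"
      by (simp add: algebra_simps power2_eq_square add_divide_distrib diff_divide_distrib)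
    then show ?thesis
      using c by simp
  qed
  from nonpos_if_le_all_multiples[OF this] show ?thesis by simp
qed

text \<open>The same limit, with minimality of \<open>x_opt\<close> on the segment as the lower
  bound in place of smoothness.\<close>

lemma quadratic_growth:
  assumes "x \<in> X"
  shows "\<mu> / 2 * (norm (x - x_opt))\<^sup>2 \<le> f x - f x_opt"
proof -
  let ?d = "(norm (x - x_opt))\<^sup>2"
  have "\<mu> / 2 * ?d - (f x - f x_opt) \<le> c * (\<mu> / 2 * ?d)" if c: "0 < c" "c < 1" for c
  proof -
    have "c *\<^sub>R x + (1 - c) *\<^sub>R x_opt \<in> X"
      using convexD[OF convex_X assms opt_in_X, of c "1 - c"] c by simp
    from opt_le[OF this] have
      "f x_opt \<le> c * f x + (1 - c) * f x_opt - \<mu> * c * (1 - c) / 2 * ?d"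
      using strongly_convexD[OF in_Y[OF assms] in_Y[OF opt_in_X], of c] c by simp
    then have "c * (\<mu> / 2 * ?d - (f x - f x_opt)) \<le> c * (c * (\<mu> / 2 * ?d))"
      by (simp add: algebra_simps add_divide_distrib diff_divide_distrib)
    then show ?thesis
      using c by simp
  qed
  from nonpos_if_le_all_multiples[OF this] show ?thesis by simp
qed

text \<open>The quadratic lower and upper bounds at \<open>x_opt\<close> are compared at a second
  point; on a one-point domain the two moduli would be unrelated. This is what makes sqrt (L /
  \<mu>) at least 1, hence \<open>K\<close> at least 6.\<close>

lemma modulus_le_smoothness:
  assumes "x \<in> X" "x \<noteq> x_opt"
  shows "\<mu> \<le> L"
proof -
  have "\<mu> / 2 * (norm (x - x_opt))\<^sup>2 \<le> L / 2 * (norm (x - x_opt))\<^sup>2"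
    using gradient_lower_bound[of x x_opt] smoothD[of x_opt x] in_Y[OF assms(1)] in_Y[OF opt_in_X]
    by linarith
  then show ?thesis
    using assms(2) by simp
qed

text \<open>
  The same inequality later gives square integrability of the iterates, so that
  no bound on the growth of \<open>grad_f\<close> is needed: when \<open>Y\<close> has empty interior, the components of
  \<open>grad_f\<close> normal to \<open>Y\<close> are arbitrary.
\<close>

lemma prox_sgd_step:
  fixes d c u x :: 'a and \<beta> \<eta> :: real
  assumes u: "u \<in> Y" and x: "x \<in> X" and \<beta>: "L \<le> \<beta>" and \<eta>: "0 < \<eta>" "2 * \<beta> * \<eta> < 1"
  defines "v \<equiv> closest_point X (u - \<eta> *\<^sub>R (grad_f u + d + \<beta> *\<^sub>R (u - c)))"
  shows "f v + \<beta> / 2 * (norm (v - c))\<^sup>2 + 1 / (2 * \<eta>) * (norm (x - v))\<^sup>2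
    \<le> f x + \<beta> / 2 * (norm (x - c))\<^sup>2 + (1 / (2 * \<eta>) - \<beta> / 2) * (norm (x - u))\<^sup>2
       + (- (d \<bullet> (u - x)) + (norm d)\<^sup>2 / (2 * (1 / \<eta> - 2 * \<beta>)))"
proof -
  define g where "g = grad_f u + d + \<beta> *\<^sub>R (u - c)"
  have v: "v \<in> X"
    unfolding v_def using x closed_X by (intro closest_point_in_set) auto
  have a: "0 < 1 / \<eta> - 2 * \<beta>"
    using \<eta> by (simp add: field_simps)
  have "2 * \<eta> * (g \<bullet> (v - x)) \<le> (norm (x - u))\<^sup>2 - (norm (x - v))\<^sup>2 - (norm (v - u))\<^sup>2"
    unfolding v_def g_def by (rule closest_point_three_point[OF closed_X convex_X x])
  then have "g \<bullet> (v - x)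
      \<le> ((norm (x - u))\<^sup>2 - (norm (x - v))\<^sup>2 - (norm (v - u))\<^sup>2) / (2 * \<eta>)"
    using \<eta> by (simp add: pos_le_divide_eq mult.commute)
  then have 1: "g \<bullet> (v - x)
      \<le> 1 / (2 * \<eta>) * (norm (x - u))\<^sup>2 - 1 / (2 * \<eta>) * (norm (x - v))\<^sup>2 - 1 / (2 * \<eta>) * (norm (v - u))\<^sup>2"
    by (simp add: diff_divide_distrib)
  have 2: "f v \<le> f u + grad_f u \<bullet> (v - u) + L / 2 * (norm (v - u))\<^sup>2"
    using smoothD[OF u in_Y[OF v]] by linarith
  \<comment> \<open>SGD works with the modulus \<beta> of the proximal term alone; \<mu> returns in
    \<open>catalyst_step\<close> and \<open>quadratic_growth\<close>.\<close>
  have "0 \<le> \<mu> / 2 * (norm (x - u))\<^sup>2"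
    using mu_pos by simp
  then have 3: "f u + grad_f u \<bullet> (x - u) \<le> f x"
    using gradient_lower_bound[OF in_Y[OF x] u] by linarith
  \<comment> \<open>The coefficient is what remains of 1 / (2 \<eta>), the gain of the projection
    step, after \<beta> / 2 has paid for smoothness and another \<beta> / 2 for the proximal term; 2
    \<beta> \<eta> < 1 keeps it positive.\<close>
  have 4: "- d \<bullet> (v - u) \<le> (norm d)\<^sup>2 / (2 * (1 / \<eta> - 2 * \<beta>)) + (1 / \<eta> - 2 * \<beta>) / 2 * (norm (v - u))\<^sup>2"
    using inner_le_power2_norm[OF a, of "- d" "v - u"] by simp
  \<comment> \<open>The proximal term is quadratic, so its linearization at \<open>u\<close> has an
    exact remainder. This is the source of the contraction term - \<beta> / 2 in front of the
    squared distance from \<open>x\<close> to \<open>u\<close>.\<close>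
  have 5: "(norm (v - c))\<^sup>2 - (norm (x - c))\<^sup>2 + (norm (x - u))\<^sup>2 - (norm (v - u))\<^sup>2 = 2 * ((u - c) \<bullet> (v - x))"
    by (simp add: power2_norm_eq_inner inner_diff inner_commute algebra_simps)
  have 6: "L / 2 * (norm (v - u))\<^sup>2 \<le> \<beta> / 2 * (norm (v - u))\<^sup>2"
    using \<beta> by (intro mult_right_mono) auto
  have 7: "g \<bullet> (v - x) = grad_f u \<bullet> (v - u) - grad_f u \<bullet> (x - u) + d \<bullet> (v - u) + d \<bullet> (u - x)
      + \<beta> * ((u - c) \<bullet> (v - x))"
    unfolding g_def by (simp add: inner_diff inner_add algebra_simps)
  have 8: "\<beta> / 2 * (norm (v - c))\<^sup>2 - \<beta> / 2 * (norm (x - c))\<^sup>2 + \<beta> / 2 * (norm (x - u))\<^sup>2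
      - \<beta> / 2 * (norm (v - u))\<^sup>2 = \<beta> * ((u - c) \<bullet> (v - x))"
    using arg_cong[OF 5, of "\<lambda>r. \<beta> / 2 * r"] by (simp add: algebra_simps)
  have 9: "(1 / \<eta> - 2 * \<beta>) / 2 * (norm (v - u))\<^sup>2
      = 1 / (2 * \<eta>) * (norm (v - u))\<^sup>2 - \<beta> * (norm (v - u))\<^sup>2"
    by (simp add: algebra_simps diff_divide_distrib)
  have 10: "(1 / (2 * \<eta>) - \<beta> / 2) * (norm (x - u))\<^sup>2
      = 1 / (2 * \<eta>) * (norm (x - u))\<^sup>2 - \<beta> / 2 * (norm (x - u))\<^sup>2"
    by (simp add: algebra_simps)
  have 11: "- d \<bullet> (v - u) = - (d \<bullet> (v - u))" by simp
  show ?thesis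
    using 1 2 3 4 6 7 8 9 10 11 by linarith
qed

end

section \<open>Weights of the SGD average and the Catalyst averaging step\<close>

lemma snd_sgd: "snd (sgd X G s \<beta> c \<eta> n t) = n + t"
  by (induction t) (auto simp: Let_def split: prod.splits)

lemma fst_sgd_Suc:
  assumes "closed X" "convex X" "X \<noteq> {}" "0 < \<eta> (Suc t)"
  shows "fst (sgd X G s \<beta> c \<eta> n (Suc t)) =
    (let u = fst (sgd X G s \<beta> c \<eta> n t)
     in closest_point X (u - \<eta> (Suc t) *\<^sub>R (G u (s (n + t)) + \<beta> *\<^sub>R (u - c))))"
  using snd_sgd[of X G s \<beta> c \<eta> n t] prox_step_eq_closest_point[OF assms]
  by (cases "sgd X G s \<beta> c \<eta> n t") (simp add: Let_def)

text \<open>The factors are (t + 7) / (t + 9), so the product telescopes in steps of two and leaves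
  the first two numerators, 56 = 7 * 8.\<close>

lemma sgd_Lambda_closed_form:
  assumes "\<beta> \<noteq> 0"
  shows "sgd_Lambda \<beta> (\<lambda>t. 2 / (\<beta> * (real t + 8))) t = 56 / ((real t + 7) * (real t + 8))"
proof (induction t)
  case (Suc t)
  have cancel: "a / b * (56 / (a * d)) = 56 / (d * b)" if "a \<noteq> 0" for a b d :: real
    using that by simp
  have "2 / (\<beta> * (real (Suc t) + 8)) * \<beta> = 2 / (real t + 9)"
    using assms by (simp add: add_ac)
  then have "1 - 2 / (\<beta> * (real (Suc t) + 8)) * \<beta> = (real t + 7) / (real t + 9)"
    by (simp add: field_simps)
  then have "sgd_Lambda \<beta> (\<lambda>t. 2 / (\<beta> * (real t + 8))) (Suc t)
      = (real t + 7) / (real t + 9) * (56 / ((real t + 7) * (real t + 8)))"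
    using Suc by (simp only: sgd_Lambda.simps)
  also have "\<dots> = 56 / ((real t + 8) * (real t + 9))"
    using cancel[of "real t + 7" "real t + 9" "real t + 8"] by linarith
  finally show ?case
    by (simp add: add_ac)
qed simp

text \<open>The weight of the iterate \<open>u\<^sub>t\<^sub>+\<^sub>1\<close> in the SGD average: indices are shifted to start at 0.\<close>

definition avg_weight :: "nat \<Rightarrow> nat \<Rightarrow> real"
  where "avg_weight T t = 2 * (real t + 8) / (real T * (real T + 15))"

lemma avg_weight_nonneg: "0 \<le> avg_weight T t"
  by (simp add: avg_weight_def)

lemma sum_linear_weights: "(\<Sum>t<T. real t + 8) = real T * (real T + 15) / 2"
  by (induction T) (auto simp: field_simps)

lemma sum_triangular: "(\<Sum>j<k. (real j + 1) * (real j + 2) / 2) = real k * (real k + 1) * (real k + 2) / 6"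
  by (induction k) (auto simp: field_simps)

lemma sum_avg_weight:
  assumes "0 < T"
  shows "(\<Sum>t<T. avg_weight T t) = 1"
proof -
  have "(\<Sum>t<T. avg_weight T t) = 2 * (\<Sum>t<T. real t + 8) / (real T * (real T + 15))"
    unfolding avg_weight_def sum_divide_distrib[symmetric] sum_distrib_left[symmetric] ..
  moreover have "real T * (real T + 15) \<noteq> 0"
    using assms by simp
  ultimately show ?thesis
    unfolding sum_linear_weights by simp
qed

text \<open>The quotients \<eta> \<beta> / \<Lambda> equal (t + 7) / 28, so the average is a convex
  combination with linearly growing weights.\<close>

lemma sgd_average_eq:
  assumes "\<beta> \<noteq> 0" "0 < T"
  defines "\<eta> \<equiv> \<lambda>t. 2 / (\<beta> * (real t + 8))"
  shows "sgd_average X G s \<beta> c \<eta> n T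
    = (\<Sum>t<T. avg_weight T t *\<^sub>R fst (sgd X G s \<beta> c \<eta> n (Suc t)))"
proof -
  have pos: "0 < real T * (real T + 15)"
    using assms by (simp add: add_pos_nonneg)
  have \<Lambda>: "sgd_Lambda \<beta> \<eta> t = 56 / ((real t + 7) * (real t + 8))" for t
    unfolding \<eta>_def using assms(1) by (rule sgd_Lambda_closed_form)
  have "1 - sgd_Lambda \<beta> \<eta> T = real T * (real T + 15) / ((real T + 7) * (real T + 8))"
    unfolding \<Lambda> by (simp add: diff_divide_eq_iff) (simp add: algebra_simps)
  then have 1: "sgd_Lambda \<beta> \<eta> T / (1 - sgd_Lambda \<beta> \<eta> T) = 56 / (real T * (real T + 15))"
    unfolding \<Lambda> using assms(2) by simp
  have 2: "\<eta> t * \<beta> / sgd_Lambda \<beta> \<eta> t = (real t + 7) / 28" for t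
    unfolding \<Lambda> unfolding \<eta>_def using assms(1) by (simp add: divide_simps)
  have rescale: "56 / S * ((r + 7) / 28) = 2 * (r + 7) / S" for r S :: real
    by (cases "S = 0") (simp_all add: field_simps)
  have "sgd_average X G s \<beta> c \<eta> n T
      = (\<Sum>t=1..T. (56 / (real T * (real T + 15)) * ((real t + 7) / 28)) *\<^sub>R fst (sgd X G s \<beta> c \<eta> n t))"
    unfolding sgd_average_def 1 2 by (simp add: scaleR_sum_right)
  also have "\<dots> = (\<Sum>t=1..T. (2 * (real t + 7) / (real T * (real T + 15))) *\<^sub>R fst (sgd X G s \<beta> c \<eta> n t))"
    unfolding rescale ..
  also have "{1..T} = Suc ` {..<T}"
    by (simp add: lessThan_atLeast0 atLeastLessThanSuc_atLeastAtMost image_Suc_atLeastLessThan)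
  finally show ?thesis
    by (simp add: sum.reindex avg_weight_def add_ac del: sgd.simps)
qed

text \<open>\<open>1 / (1 - \<Lambda>\<^sub>T)\<close> for the value \<open>\<Lambda>\<^sub>T = 56 / ((T + 7) (T + 8))\<close> of the SGD recursion.\<close>

definition kappa :: "nat \<Rightarrow> real"
  where "kappa T = (real T + 7) * (real T + 8) / (real T * (real T + 15))"

lemma kappa_eq:
  assumes "0 < T"
  shows "kappa T = 1 + 56 / (real T * (real T + 15))"
proof -
  have "(real T + 7) * (real T + 8) = real T * (real T + 15) + 56"
    by (simp add: algebra_simps)
  then show ?thesis
    unfolding kappa_def using assms by (simp add: add_divide_distrib)
qed

lemma kappa_pos: "0 < T \<Longrightarrow> 0 < kappa T"
  unfolding kappa_def by simp

lemma power2_norm_weighted_add: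
  fixes a b :: "'a::real_inner"
  assumes "0 \<le> p" "0 \<le> q"
  shows "(norm (p *\<^sub>R a + q *\<^sub>R b))\<^sup>2 \<le> (p + q) * (p * (norm a)\<^sup>2 + q * (norm b)\<^sup>2)"
proof -
  have "(p + q) * (p * (norm a)\<^sup>2 + q * (norm b)\<^sup>2) - (norm (p *\<^sub>R a + q *\<^sub>R b))\<^sup>2
      = p * q * (norm (a - b))\<^sup>2"
    by (simp add: power2_norm_eq_inner inner_add inner_diff inner_commute algebra_simps)
  moreover have "0 \<le> p * q * (norm (a - b))\<^sup>2"
    using assms by simp
  ultimately show ?thesis by linarith
qed

text \<open>
  The averaging step of Catalyst uses the weight \<open>\<alpha>\<close>, computed from \<open>90 / ((T + 9) (T + 10))\<close>, while
  SGD only guarantees the smaller weight \<open>a = \<kappa> \<beta>\<close>.  The mismatch costs a factor \<open>a / \<alpha>\<close> of the strong convexity term, which is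
  harmless.
\<close>

lemma catalyst_averaging:
  fixes x_opt x_tilde u :: "'a::real_inner"
  assumes a: "0 < a" "a \<le> \<alpha>" and \<gamma>: "0 < \<gamma>" "\<gamma> \<le> 1" and \<mu>: "0 \<le> \<mu>"
  defines "x \<equiv> \<gamma> *\<^sub>R x_opt + (1 - \<gamma>) *\<^sub>R x_tilde"
    and "x_bar \<equiv> (1 / (\<alpha> * \<gamma> + \<mu> * (1 - \<gamma>))) *\<^sub>R (\<alpha> *\<^sub>R u + ((\<mu> - \<alpha>) * (1 - \<gamma>)) *\<^sub>R x_tilde)"
  shows "a * \<gamma>\<^sup>2 * (norm (x_opt - x_bar))\<^sup>2
    \<le> a * (norm (x - u))\<^sup>2 + \<mu> * \<gamma> * (1 - \<gamma>) * (norm (x_opt - x_tilde))\<^sup>2"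
proof -
  define W where "W = \<alpha> * \<gamma> + \<mu> * (1 - \<gamma>)"
  have \<alpha>: "0 < \<alpha>" using a by linarith
  have W: "0 < W" "\<alpha> * \<gamma> \<le> W"
    unfolding W_def using \<alpha> \<gamma> \<mu> by (simp_all add: add_pos_nonneg)
  let ?d = "(norm (x_opt - x_bar))\<^sup>2" and ?b = "(norm (x_opt - x_tilde))\<^sup>2"
  have "W *\<^sub>R x_bar = \<alpha> *\<^sub>R u + ((\<mu> - \<alpha>) * (1 - \<gamma>)) *\<^sub>R x_tilde"
    unfolding x_bar_def W_def[symmetric] using W by simp
  \<comment> \<open>The coefficients of the averaging step are such that \<open>x_tilde\<close>
    survives only inside \<open>x\<close> and in its difference from \<open>x_opt\<close>.\<close>
  then have "W *\<^sub>R (x_opt - x_bar) = \<alpha> *\<^sub>R (x - u) + (\<mu> * (1 - \<gamma>)) *\<^sub>R (x_opt - x_tilde)"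
    unfolding x_def by (simp add: W_def algebra_simps)
  \<comment> \<open>Pulling out \<alpha> \<gamma> makes the two weights add up to \<open>W\<close>,
    so that one factor \<open>W\<close> cancels after the weighted convexity bound.\<close>
  also have "\<alpha> *\<^sub>R (x - u) = (\<alpha> * \<gamma>) *\<^sub>R ((1 / \<gamma>) *\<^sub>R (x - u))"
    using \<gamma> by simp
  finally have "W\<^sup>2 * ?d
      \<le> W * (\<alpha> * \<gamma> * (norm ((1 / \<gamma>) *\<^sub>R (x - u)))\<^sup>2 + \<mu> * (1 - \<gamma>) * ?b)"
    using power2_norm_weighted_add[of "\<alpha> * \<gamma>" "\<mu> * (1 - \<gamma>)" "(1 / \<gamma>) *\<^sub>R (x - u)" "x_opt - x_tilde"]
      \<alpha> \<gamma> \<mu> by (metis W_def diff_ge_0_iff_ge less_eq_real_def mult_nonneg_nonneg norm_scaleR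
        power2_abs power_mult_distrib)
  then have "W * ?d \<le> \<alpha> * \<gamma> * (norm ((1 / \<gamma>) *\<^sub>R (x - u)))\<^sup>2 + \<mu> * (1 - \<gamma>) * ?b"
    using W by (simp add: power2_eq_square)
  also have "\<alpha> * \<gamma> * (norm ((1 / \<gamma>) *\<^sub>R (x - u)))\<^sup>2 = \<alpha> * (norm (x - u))\<^sup>2 / \<gamma>"
    using \<gamma> by (simp add: power2_eq_square)
  finally have "\<gamma> * (W * ?d) \<le> \<gamma> * (\<alpha> * (norm (x - u))\<^sup>2 / \<gamma> + \<mu> * (1 - \<gamma>) * ?b)"
    using \<gamma> by (intro mult_left_mono) auto
  also have "\<dots> = \<alpha> * (norm (x - u))\<^sup>2 + \<mu> * \<gamma> * (1 - \<gamma>) * ?b"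
    using \<gamma> by (simp add: distrib_left)
  finally have 1: "\<gamma> * (W * ?d) \<le> \<alpha> * (norm (x - u))\<^sup>2 + \<mu> * \<gamma> * (1 - \<gamma>) * ?b" .
  have "\<alpha> * \<gamma>\<^sup>2 * ?d \<le> \<gamma> * (W * ?d)"
    using mult_left_mono[OF mult_right_mono[OF W(2), of ?d], of \<gamma>] \<gamma>
    by (simp add: power2_eq_square mult_ac)
  with 1 have "a / \<alpha> * (\<alpha> * \<gamma>\<^sup>2 * ?d) \<le> a / \<alpha> * (\<alpha> * (norm (x - u))\<^sup>2 + \<mu> * \<gamma> * (1 - \<gamma>) * ?b)"
    using a \<alpha> by (intro mult_left_mono) auto
  then have "a * \<gamma>\<^sup>2 * ?d \<le> a * (norm (x - u))\<^sup>2 + a / \<alpha> * (\<mu> * \<gamma> * (1 - \<gamma>) * ?b)"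
    using \<alpha> by (simp add: distrib_left)
  also have "a / \<alpha> * (\<mu> * \<gamma> * (1 - \<gamma>) * ?b) \<le> 1 * (\<mu> * \<gamma> * (1 - \<gamma>) * ?b)"
    using a \<alpha> \<gamma> \<mu> by (intro mult_right_mono) auto
  finally show ?thesis by simp
qed

section \<open>The SGD bound over one inner loop\<close>

context smooth_strongly_convex_problem
begin

definition oracle_error :: "'a \<Rightarrow> 's \<Rightarrow> 'a"
  where "oracle_error u z = G u z - grad_f u"

lemma X_nonempty: "X \<noteq> {}"
  using opt_in_X by blast

lemma convex_f_X: "convex_on X f"
  using convex_f X_subset_Y convex_X by (rule convex_on_subset)

text \<open>The step size at index t + 1 is 2 / (\<beta> (t + 9)), so 2 \<beta> \<eta> = 4 / (t + 9)
  lies below 1. The distance coefficients t + 9 after the step and t + 7 before it are two apart,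
  which is what linear weights can telescope.\<close>

lemma prox_sgd_step_closed_form:
  fixes u c x :: 'a and \<beta> :: real and z :: 's and t :: nat
  assumes u: "u \<in> Y" and x: "x \<in> X" and \<beta>: "L \<le> \<beta>"
  defines "v \<equiv> closest_point X (u - (2 / (\<beta> * (real (Suc t) + 8))) *\<^sub>R (G u z + \<beta> *\<^sub>R (u - c)))"
  shows "f v + \<beta> / 2 * (norm (v - c))\<^sup>2 + \<beta> * (real t + 9) / 4 * (norm (x - v))\<^sup>2
    \<le> f x + \<beta> / 2 * (norm (x - c))\<^sup>2 + \<beta> * (real t + 7) / 4 * (norm (x - u))\<^sup>2
       + (- (oracle_error u z \<bullet> (u - x)) + (norm (oracle_error u z))\<^sup>2 / (\<beta> * (real t + 5)))"
proof -
  define \<eta> where "\<eta> = 2 / (\<beta> * (real (Suc t) + 8))"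
  have \<beta>0: "0 < \<beta>" using \<beta> L_pos by linarith
  have "2 * \<beta> * \<eta> = 4 / (real t + 9)"
    unfolding \<eta>_def using \<beta>0 by simp
  then have \<eta>: "0 < \<eta>" "2 * \<beta> * \<eta> < 1"
    unfolding \<eta>_def using \<beta>0 by simp_all
  have 1: "1 / (2 * \<eta>) = \<beta> * (real t + 9) / 4"
    unfolding \<eta>_def using \<beta>0 by simp
  have 2: "1 / (2 * \<eta>) - \<beta> / 2 = \<beta> * (real t + 7) / 4"
    unfolding 1 by (simp add: field_simps)
  have 3: "2 * (1 / \<eta> - 2 * \<beta>) = \<beta> * (real t + 5)"
    unfolding \<eta>_def using \<beta>0 by (simp add: field_simps)
  have 4: "v = closest_point X (u - \<eta> *\<^sub>R (grad_f u + oracle_error u z + \<beta> *\<^sub>R (u - c)))"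
    unfolding v_def \<eta>_def oracle_error_def by simp
  show ?thesis
    using prox_sgd_step[OF u x \<beta> \<eta>, of "oracle_error u z" c] unfolding 4[symmetric] 1 2 3
    by (simp only: 2[unfolded 1])
qed

context
  fixes s :: "nat \<Rightarrow> 's" and \<beta> :: real and c :: 'a and n :: nat
  assumes \<beta>: "L \<le> \<beta>"
begin

private definition "\<eta> = (\<lambda>t. 2 / (\<beta> * (real t + 8)))"
private definition "U t = fst (sgd X G s \<beta> c \<eta> n t)"

lemma beta_pos: "0 < \<beta>"
  using \<beta> L_pos by linarith

lemma sgd_Suc:
  "fst (sgd X G s \<beta> c (\<lambda>t. 2 / (\<beta> * (real t + 8))) n (Suc t)) =
    (let u = fst (sgd X G s \<beta> c (\<lambda>t. 2 / (\<beta> * (real t + 8))) n t) in closest_point X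
      (u - (2 / (\<beta> * (real (Suc t) + 8))) *\<^sub>R (G u (s (n + t)) + \<beta> *\<^sub>R (u - c))))"
  using beta_pos by (intro fst_sgd_Suc closed_X convex_X X_nonempty) simp

lemma sgd_Suc_in_X: "fst (sgd X G s \<beta> c (\<lambda>t. 2 / (\<beta> * (real t + 8))) n (Suc t)) \<in> X"
  unfolding sgd_Suc Let_def by (intro closest_point_in_set closed_X X_nonempty)

lemma sgd_average_in_X:
  assumes "0 < T"
  shows "sgd_average X G s \<beta> c (\<lambda>t. 2 / (\<beta> * (real t + 8))) n T \<in> X"
  using beta_pos assms
  by (subst sgd_average_eq)
    (auto intro!: convex_sum convex_X sum_avg_weight avg_weight_nonneg sgd_Suc_in_X simp del: sgd.simps)

lemma prox_sgd_bound:
  assumes c: "c \<in> Y" and x: "x \<in> X" and T: "0 < T"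
  shows "f (sgd_average X G s \<beta> c (\<lambda>t. 2 / (\<beta> * (real t + 8))) n T)
      + kappa T * \<beta> / 2 * (norm (x - fst (sgd X G s \<beta> c (\<lambda>t. 2 / (\<beta> * (real t + 8))) n T)))\<^sup>2
    \<le> f x + kappa T * \<beta> / 2 * (norm (x - c))\<^sup>2
      + (\<Sum>t<T. avg_weight T t *
          (let u = fst (sgd X G s \<beta> c (\<lambda>t. 2 / (\<beta> * (real t + 8))) n t);
               d = oracle_error u (s (n + t))
           in - (d \<bullet> (u - x)) + (norm d)\<^sup>2 / (\<beta> * (real t + 5))))"
proof -
  define \<nu> where "\<nu> t = - (oracle_error (U t) (s (n + t)) \<bullet> (U t - x))
    + (norm (oracle_error (U t) (s (n + t))))\<^sup>2 / (\<beta> * (real t + 5))" for t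
  define \<phi> where "\<phi> v = f v + \<beta> / 2 * (norm (v - c))\<^sup>2" for v
  have \<beta>0: "0 < \<beta>" by (rule beta_pos)
  have U0: "U 0 = c" unfolding U_def by simp
  have U_in_X: "U (Suc t) \<in> X" for t
    unfolding U_def \<eta>_def by (rule sgd_Suc_in_X)
  have U_in_Y: "U t \<in> Y" for t
    using U0 c U_in_X in_Y by (cases t) auto
  have step: "\<phi> (U (Suc t)) + \<beta> * (real t + 9) / 4 * (norm (x - U (Suc t)))\<^sup>2
      \<le> \<phi> x + \<beta> * (real t + 7) / 4 * (norm (x - U t))\<^sup>2 + \<nu> t" for t
    unfolding \<phi>_def \<nu>_def
    using prox_sgd_step_closed_form[OF U_in_Y x \<beta>, of t t "s (n + t)" c] sgd_Suc[of t]
    unfolding U_def \<eta>_def Let_def by simp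
  \<comment> \<open>Multiplying step \<open>t\<close> by t + 8 makes the coefficients (t + 7) (t +
    8) and (t + 8) (t + 9) consecutive. The initial one gives 14 = 7 * 8 / 4.\<close>
  have telescope: "(\<Sum>t<m. (real t + 8) * \<phi> (U (Suc t)))
        + \<beta> * ((real m + 7) * (real m + 8)) / 4 * (norm (x - U m))\<^sup>2
      \<le> (\<Sum>t<m. (real t + 8)) * \<phi> x + 14 * \<beta> * (norm (x - c))\<^sup>2 + (\<Sum>t<m. (real t + 8) * \<nu> t)" for m
  proof (induction m)
    case (Suc m)
    have A: "(real m + 8) * (a + \<beta> * p / 4 * q) = (real m + 8) * a + \<beta> * ((real m + 8) * p) / 4 * q"
      "(real m + 8) * (a + \<beta> * p / 4 * q + b) = (real m + 8) * a + \<beta> * (p * (real m + 8)) / 4 * q + (real m + 8) * b"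
      for a b p q
      by (simp_all add: algebra_simps)
    have "(real m + 8) * (\<phi> (U (Suc m)) + \<beta> * (real m + 9) / 4 * (norm (x - U (Suc m)))\<^sup>2)
        \<le> (real m + 8) * (\<phi> x + \<beta> * (real m + 7) / 4 * (norm (x - U m))\<^sup>2 + \<nu> m)"
      by (intro mult_left_mono step) simp
    then have "(real m + 8) * \<phi> (U (Suc m)) + \<beta> * ((real m + 8) * (real m + 9)) / 4 * (norm (x - U (Suc m)))\<^sup>2
        \<le> (real m + 8) * \<phi> x + \<beta> * ((real m + 7) * (real m + 8)) / 4 * (norm (x - U m))\<^sup>2 + (real m + 8) * \<nu> m"
      by (simp only: A)
    moreover have "real (Suc m) + 7 = real m + 8" "real (Suc m) + 8 = real m + 9"
      by auto
    ultimately show ?case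
      using Suc by (simp only: sum.lessThan_Suc distrib_right)
  qed (simp add: U0)
  define p where "p = 2 / (real T * (real T + 15))"
  have S: "0 < real T * (real T + 15)"
    using T by (simp add: add_pos_nonneg)
  have p: "0 \<le> p" "p * ((\<Sum>t<T. real t + 8) * r) = r" "p * (14 * \<beta> * r) = 28 / (real T * (real T + 15)) * \<beta> * r" for r
    unfolding p_def sum_linear_weights using T by simp_all
  have scale: "p * (\<Sum>t<T. (real t + 8) * h t) = (\<Sum>t<T. avg_weight T t * h t)" for h
    unfolding p_def avg_weight_def sum_distrib_left by (intro sum.cong) auto
  have k: "p * (\<beta> * ((real T + 7) * (real T + 8)) / 4 * r) = kappa T * \<beta> / 2 * r" for r
  proof -
    have "2 / D * (\<beta> * N / 4 * r) = N / D * \<beta> / 2 * r" for D N :: real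
      by simp
    then show ?thesis
      unfolding kappa_def p_def .
  qed
  have "p * ((\<Sum>t<T. (real t + 8) * \<phi> (U (Suc t)))
        + \<beta> * ((real T + 7) * (real T + 8)) / 4 * (norm (x - U T))\<^sup>2)
      \<le> p * ((\<Sum>t<T. (real t + 8)) * \<phi> x + 14 * \<beta> * (norm (x - c))\<^sup>2
        + (\<Sum>t<T. (real t + 8) * \<nu> t))"
    by (intro mult_left_mono telescope p)
  then have "(\<Sum>t<T. avg_weight T t * \<phi> (U (Suc t))) + kappa T * \<beta> / 2 * (norm (x - U T))\<^sup>2
      \<le> \<phi> x + 28 / (real T * (real T + 15)) * \<beta> * (norm (x - c))\<^sup>2 + (\<Sum>t<T. avg_weight T t * \<nu> t)"
    unfolding distrib_left[of p] scale k p .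
  \<comment> \<open>The remaining initial distance has coefficient (\<kappa> - 1) \<beta> / 2, and
    the proximal term inside \<open>\<phi> x\<close> supplies the missing \<beta> / 2. Hence both
    ends carry \<kappa> \<beta> / 2.\<close>
  also have "\<phi> x + 28 / (real T * (real T + 15)) * \<beta> * (norm (x - c))\<^sup>2
      = f x + kappa T * \<beta> / 2 * (norm (x - c))\<^sup>2"
    unfolding \<phi>_def kappa_eq[OF T] by (simp add: algebra_simps)
  finally have main: "(\<Sum>t<T. avg_weight T t * \<phi> (U (Suc t))) + kappa T * \<beta> / 2 * (norm (x - U T))\<^sup>2
      \<le> f x + kappa T * \<beta> / 2 * (norm (x - c))\<^sup>2 + (\<Sum>t<T. avg_weight T t * \<nu> t)" .
  have avg: "sgd_average X G s \<beta> c \<eta> n T = (\<Sum>t<T. avg_weight T t *\<^sub>R U (Suc t))"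
    unfolding U_def \<eta>_def using \<beta>0 T by (intro sgd_average_eq) auto
  have "f (sgd_average X G s \<beta> c \<eta> n T) \<le> (\<Sum>t<T. avg_weight T t * f (U (Suc t)))"
    unfolding avg using T
    by (intro convex_on_sum[OF _ _ convex_f_X]) (auto simp: sum_avg_weight avg_weight_nonneg U_in_X)
  \<comment> \<open>After Jensen's inequality for \<open>f\<close>, the nonnegative proximal terms
    at the iterates are given away.\<close>
  also have "\<dots> \<le> (\<Sum>t<T. avg_weight T t * \<phi> (U (Suc t)))"
    using \<beta>0 by (intro sum_mono mult_left_mono avg_weight_nonneg) (simp add: \<phi>_def)
  finally show ?thesis
    using main unfolding \<nu>_def U_def \<eta>_def Let_def by simp
qed

end

end

section \<open>Catalyst along one sample path\<close>

context smooth_strongly_convex_problem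
begin

definition gam :: "nat \<Rightarrow> real"
  where "gam k = 2 / (real k + 1)"

text \<open>At 0 the division yields 0. Iterations are numbered from 1, so the bounds on this
  parameter are stated at \<open>Suc j\<close>.\<close>

definition bet :: "nat \<Rightarrow> real"
  where "bet k = (real k + 1) * L / real k"

definition eta :: "nat \<Rightarrow> nat \<Rightarrow> real"
  where "eta k t = 2 / (bet k * (real t + 8))"

lemma eta_eq: "eta k = (\<lambda>t. 2 / (bet k * (real t + 8)))"
  by (simp add: eta_def fun_eq_iff)

lemma L_le_bet: "L \<le> bet (Suc j)"
  unfolding bet_def using L_pos by (simp add: field_simps)

lemma bet_pos: "0 < bet (Suc j)"
  using L_le_bet[of j] L_pos by linarith

text \<open>The reason for the weight k (k + 1) / 2: it makes the coefficient of the distance to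
  \<open>x_bar\<close> the same in every iteration.\<close>

lemma bet_gam: "bet (Suc j) * (gam (Suc j))\<^sup>2 * ((real j + 1) * (real j + 2) / 2) = 2 * L"
proof -
  have "p * L / q * (2 / p)\<^sup>2 * (q * p / 2) = 2 * L" if "p \<noteq> 0" "q \<noteq> 0" for p q :: real
    using that by (simp add: power2_eq_square)
  from this[of "real j + 2" "real j + 1"] show ?thesis
    unfolding bet_def gam_def by (simp add: add_ac)
qed

lemma gam_bounds: "0 < gam (Suc j)" "gam (Suc j) \<le> 1"
  unfolding gam_def by simp_all

context
  fixes s :: "nat \<Rightarrow> 's" and \<alpha> :: "nat \<Rightarrow> real" and T :: nat and x :: 'a and n :: nat
begin

definition x_bar :: "nat \<Rightarrow> 'a"
  where "x_bar j = fst (catalyst X G s \<mu> gam bet eta \<alpha> T x n j)"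

definition x_tilde :: "nat \<Rightarrow> 'a"
  where "x_tilde j = fst (snd (catalyst X G s \<mu> gam bet eta \<alpha> T x n j))"

definition center :: "nat \<Rightarrow> 'a"
  where "center j = prox_center gam (Suc j) (x_bar j) (x_tilde j)"

text \<open>Every iteration consumes exactly \<open>T\<close> samples, so the sample index is
  written out instead of being read from the state; \<open>catalyst_calls\<close> justifies
  this.\<close>

definition inner_iterate :: "nat \<Rightarrow> nat \<Rightarrow> 'a"
  where "inner_iterate j t = fst (sgd X G s (bet (Suc j)) (center j) (eta (Suc j)) (n + j * T) t)"

text \<open>The comparison point for SGD in iteration j + 1. It is fixed before that iteration draws
  its first sample, which is what makes the linear noise terms unbiased.\<close>

definition anchor :: "nat \<Rightarrow> 'a"
  where "anchor j = gam (Suc j) *\<^sub>R x_opt + (1 - gam (Suc j)) *\<^sub>R x_tilde j"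

definition step_error :: "nat \<Rightarrow> nat \<Rightarrow> 'a"
  where "step_error j t = oracle_error (inner_iterate j t) (s (n + j * T + t))"

definition step_noise :: "nat \<Rightarrow> nat \<Rightarrow> real"
  where "step_noise j t = - (step_error j t \<bullet> (inner_iterate j t - anchor j))
    + (norm (step_error j t))\<^sup>2 / (bet (Suc j) * (real t + 5))"

definition total_noise :: "nat \<Rightarrow> real"
  where "total_noise K = (\<Sum>j<K. (real j + 1) * (real j + 2) / 2 * (\<Sum>t<T. avg_weight T t * step_noise j t))"

lemma x_bar_0: "x_bar 0 = x" and x_tilde_0: "x_tilde 0 = x"
  by (simp_all add: x_bar_def x_tilde_def)

lemma inner_iterate_0: "inner_iterate j 0 = center j"
  by (simp add: inner_iterate_def)

lemma center_eq: "center j = gam (Suc j) *\<^sub>R x_bar j + (1 - gam (Suc j)) *\<^sub>R x_tilde j"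
  by (simp add: center_def prox_center_def)

lemma inner_iterate_Suc:
  "inner_iterate j (Suc t) = closest_point X (inner_iterate j t - (2 / (bet (Suc j) * (real (Suc t) + 8))) *\<^sub>R
      (G (inner_iterate j t) (s (n + j * T + t)) + bet (Suc j) *\<^sub>R (inner_iterate j t - center j)))"
  unfolding inner_iterate_def eta_eq
  using sgd_Suc[OF L_le_bet, of s j "center j" "n + j * T" t] by (simp add: Let_def)

lemma inner_iterate_Suc_in_X: "inner_iterate j (Suc t) \<in> X"
  unfolding inner_iterate_Suc by (intro closest_point_in_set closed_X X_nonempty)

lemma catalyst_calls: "snd (snd (catalyst X G s \<mu> gam bet eta \<alpha> T x n j)) = n + j * T"
  by (induction j) (auto simp: Let_def snd_sgd split: prod.splits dest: arg_cong[where f = snd] simp del: sgd.simps)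

lemma catalyst_eq: "catalyst X G s \<mu> gam bet eta \<alpha> T x n j = (x_bar j, x_tilde j, n + j * T)"
  by (simp add: x_bar_def x_tilde_def catalyst_calls[symmetric])

lemma catalyst_Suc:
  shows x_bar_Suc: "x_bar (Suc j) =
      (1 / (\<alpha> (Suc j) * gam (Suc j) + \<mu> * (1 - gam (Suc j)))) *\<^sub>R
        (\<alpha> (Suc j) *\<^sub>R inner_iterate j T + ((\<mu> - \<alpha> (Suc j)) * (1 - gam (Suc j))) *\<^sub>R x_tilde j)"
    and x_tilde_Suc_sgd: "x_tilde (Suc j) =
      sgd_average X G s (bet (Suc j)) (center j) (eta (Suc j)) (n + j * T) T"
proof -
  have "catalyst X G s \<mu> gam bet eta \<alpha> T x n (Suc j) =
    ((1 / (\<alpha> (Suc j) * gam (Suc j) + \<mu> * (1 - gam (Suc j)))) *\<^sub>R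
        (\<alpha> (Suc j) *\<^sub>R inner_iterate j T + ((\<mu> - \<alpha> (Suc j)) * (1 - gam (Suc j))) *\<^sub>R x_tilde j),
      sgd_average X G s (bet (Suc j)) (center j) (eta (Suc j)) (n + j * T) T, n + j * T + T)"
    using snd_sgd[of X G s "bet (Suc j)" "center j" "eta (Suc j)" "n + j * T" T]
    by (simp only: catalyst.simps catalyst_eq Let_def prod.case center_def[symmetric] inner_iterate_def
        case_prod_beta fst_conv snd_conv)
  then show "x_bar (Suc j) =
      (1 / (\<alpha> (Suc j) * gam (Suc j) + \<mu> * (1 - gam (Suc j)))) *\<^sub>R
        (\<alpha> (Suc j) *\<^sub>R inner_iterate j T + ((\<mu> - \<alpha> (Suc j)) * (1 - gam (Suc j))) *\<^sub>R x_tilde j)"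
    and "x_tilde (Suc j) =
      sgd_average X G s (bet (Suc j)) (center j) (eta (Suc j)) (n + j * T) T"
    by (simp_all only: x_bar_def x_tilde_def fst_conv snd_conv)
qed

context
  assumes T: "0 < T" and x: "x \<in> X"
begin

lemma x_tilde_Suc: "x_tilde (Suc j) = (\<Sum>t<T. avg_weight T t *\<^sub>R inner_iterate j (Suc t))"
  unfolding x_tilde_Suc_sgd inner_iterate_def eta_eq
  using bet_pos[of j] T by (intro sgd_average_eq) auto

lemma x_tilde_in_X: "x_tilde j \<in> X"
proof (cases j)
  case (Suc i)
  then show ?thesis
    unfolding Suc x_tilde_Suc_sgd eta_eq by (intro sgd_average_in_X L_le_bet T)
qed (simp add: x_tilde_0 x)

lemma anchor_in_X: "anchor j \<in> X"
  unfolding anchor_def using gam_bounds[of j] by (intro convexD convex_X opt_in_X x_tilde_in_X) auto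

lemma inner_iterate_in_Y: "center j \<in> Y \<Longrightarrow> inner_iterate j t \<in> Y"
  using inner_iterate_0 inner_iterate_Suc_in_X in_Y by (cases t) auto

text \<open>With \<open>x_opt\<close> as the reference point the function values drop out, since
  \<open>f\<close> at the new iterate is no smaller. What remains involves only the previous
  iterate, the center and the oracle error, and so propagates square integrability.\<close>

lemma inner_iterate_dist_opt:
  assumes "center j \<in> Y"
  shows "(norm (x_opt - inner_iterate j (Suc t)))\<^sup>2
    \<le> (norm (x_opt - inner_iterate j t))\<^sup>2 + (norm (x_opt - center j))\<^sup>2
      + 4 / (bet (Suc j) * (real t + 9)) * (- (step_error j t \<bullet> (inner_iterate j t - x_opt)) + (norm (step_error j t))\<^sup>2 / (bet (Suc j) * (real t + 5)))"
proof -
  let ?v = "inner_iterate j (Suc t)" and ?u = "inner_iterate j t" and ?\<beta> = "bet (Suc j)" and ?c = "center j"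
  define \<nu> where "\<nu> = - (step_error j t \<bullet> (?u - x_opt)) + (norm (step_error j t))\<^sup>2 / (?\<beta> * (real t + 5))"
  define a b e where "a = (norm (x_opt - ?v))\<^sup>2" and "b = (norm (x_opt - ?u))\<^sup>2"
    and "e = (norm (x_opt - ?c))\<^sup>2"
  have pos: "0 < ?\<beta>" by (rule bet_pos)
  have "f ?v + ?\<beta> / 2 * (norm (?v - ?c))\<^sup>2 + ?\<beta> * (real t + 9) / 4 * a
      \<le> f x_opt + ?\<beta> / 2 * e + ?\<beta> * (real t + 7) / 4 * b + \<nu>"
    unfolding \<nu>_def a_def b_def e_def step_error_def inner_iterate_Suc
    by (intro prox_sgd_step_closed_form inner_iterate_in_Y assms opt_in_X L_le_bet)
  moreover have "f x_opt \<le> f ?v"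
    by (intro opt_le inner_iterate_Suc_in_X)
  moreover have "0 \<le> ?\<beta> / 2 * (norm (?v - ?c))\<^sup>2"
    using pos by simp
  ultimately have *: "?\<beta> * (real t + 9) / 4 * a \<le> ?\<beta> / 2 * e + ?\<beta> * (real t + 7) / 4 * b + \<nu>"
    by linarith
  have scale: "4 / (?\<beta> * r) * (?\<beta> * r / 4 * y) = y" "4 / (?\<beta> * r) * (?\<beta> / 2 * y) = 2 / r * y"
    "4 / (?\<beta> * r) * (?\<beta> * q / 4 * y) = q / r * y" if "r \<noteq> 0" for r q y
    using pos that by simp_all
  have r: "real t + 9 \<noteq> 0" by simp
  from * have "4 / (?\<beta> * (real t + 9)) * (?\<beta> * (real t + 9) / 4 * a)
      \<le> 4 / (?\<beta> * (real t + 9)) * (?\<beta> / 2 * e + ?\<beta> * (real t + 7) / 4 * b + \<nu>)"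
    using pos by (intro mult_left_mono) auto
  then have "a \<le> 2 / (real t + 9) * e + (real t + 7) / (real t + 9) * b + 4 / (?\<beta> * (real t + 9)) * \<nu>"
    unfolding distrib_left[of "4 / (?\<beta> * (real t + 9))"] by (simp only: scale[OF r] divide_self[OF r] mult_1)
  \<comment> \<open>Only finiteness of second moments is at stake, so both factors are rounded up to
    1.\<close>
  moreover have "2 / (real t + 9) * e \<le> 1 * e" "(real t + 7) / (real t + 9) * b \<le> 1 * b"
    unfolding e_def b_def by (intro mult_right_mono; simp)+
  ultimately show ?thesis
    unfolding a_def b_def e_def \<nu>_def by linarith
qed

text \<open>The SGD bound at \<open>anchor\<close> is combined with strong convexity between
  \<open>x_opt\<close> and \<open>x_tilde\<close>. The negative quadratic term of the latter cancels
  exactly the extra term produced by \<open>catalyst_averaging\<close>.\<close>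

lemma catalyst_step:
  assumes \<alpha>: "kappa T * bet (Suc j) \<le> \<alpha> (Suc j)" and c: "center j \<in> Y"
  shows "(real j + 1) * (real j + 2) / 2 * (f (x_tilde (Suc j)) - f x_opt)
      + kappa T * L * (norm (x_opt - x_bar (Suc j)))\<^sup>2
    \<le> real j * (real j + 1) / 2 * (f (x_tilde j) - f x_opt)
      + kappa T * L * (norm (x_opt - x_bar j))\<^sup>2
      + (real j + 1) * (real j + 2) / 2 * (\<Sum>t<T. avg_weight T t * step_noise j t)"
proof -
  let ?\<gamma> = "gam (Suc j)" and ?a = "kappa T * bet (Suc j)" and ?w = "(real j + 1) * (real j + 2) / 2"
  define N where "N = (\<Sum>t<T. avg_weight T t * step_noise j t)"
  define D D' where "D = (norm (x_opt - x_bar j))\<^sup>2" and "D' = (norm (x_opt - x_bar (Suc j)))\<^sup>2"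
  have \<gamma>: "0 < ?\<gamma>" "?\<gamma> \<le> 1" by (rule gam_bounds)+
  have a: "0 < ?a"
    using kappa_pos[OF T] bet_pos by simp
  have "anchor j - center j = ?\<gamma> *\<^sub>R (x_opt - x_bar j)"
    unfolding anchor_def center_eq by (simp add: algebra_simps)
  then have 1: "(norm (anchor j - center j))\<^sup>2 = ?\<gamma>\<^sup>2 * D"
    by (simp add: power_mult_distrib D_def)
  have 2: "f (x_tilde (Suc j)) + ?a / 2 * (norm (anchor j - inner_iterate j T))\<^sup>2
      \<le> f (anchor j) + ?a / 2 * (?\<gamma>\<^sup>2 * D) + N"
    using prox_sgd_bound[OF L_le_bet[of j] c anchor_in_X[of j] T, where s = s and n = "n + j * T"]
    unfolding 1 x_tilde_Suc_sgd N_def eta_eq inner_iterate_def step_noise_def step_error_def Let_def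
    by (simp add: add.assoc)
  have 3: "f (anchor j) \<le> ?\<gamma> * f x_opt + (1 - ?\<gamma>) * f (x_tilde j)
      - \<mu> * ?\<gamma> * (1 - ?\<gamma>) / 2 * (norm (x_opt - x_tilde j))\<^sup>2"
    unfolding anchor_def using \<gamma> by (intro strongly_convexD in_Y opt_in_X x_tilde_in_X) auto
  have 4: "?a * ?\<gamma>\<^sup>2 * D'
      \<le> ?a * (norm (anchor j - inner_iterate j T))\<^sup>2 + \<mu> * ?\<gamma> * (1 - ?\<gamma>) * (norm (x_opt - x_tilde j))\<^sup>2"
    unfolding D'_def x_bar_Suc anchor_def using a \<alpha> \<gamma> mu_pos by (intro catalyst_averaging) auto
  have "f (x_tilde (Suc j)) - f x_opt + ?a * ?\<gamma>\<^sup>2 / 2 * D'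
      \<le> (1 - ?\<gamma>) * (f (x_tilde j) - f x_opt) + ?a * ?\<gamma>\<^sup>2 / 2 * D + N"
    using 2 3 4 by (simp add: algebra_simps add_divide_distrib diff_divide_distrib)
  then have 5: "?w * (f (x_tilde (Suc j)) - f x_opt + ?a * ?\<gamma>\<^sup>2 / 2 * D')
      \<le> ?w * ((1 - ?\<gamma>) * (f (x_tilde j) - f x_opt) + ?a * ?\<gamma>\<^sup>2 / 2 * D + N)"
    by (intro mult_left_mono) auto
  have 6: "?w * (?a * ?\<gamma>\<^sup>2 / 2 * r) = kappa T * L * r" for r
    using arg_cong[OF bet_gam[of j], of "\<lambda>y. kappa T * y * r / 2"] by (simp add: mult_ac)
  \<comment> \<open>With k = j + 1 this is (1 - \<gamma>) k (k + 1) / 2 = (k - 1) k / 2, the weight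
    of the preceding gap.\<close>
  have "?w * (1 - ?\<gamma>) = real j * (real j + 1) / 2"
    unfolding gam_def by (simp add: field_simps)
  then have 7: "?w * ((1 - ?\<gamma>) * r) = real j * (real j + 1) / 2 * r" for r
    by (simp only: mult.assoc[symmetric])
  show ?thesis
    using 5 unfolding distrib_left[of ?w] 6 7 D_def D'_def N_def .
qed

lemma catalyst_pathwise_bound:
  assumes "\<And>j. j < K \<Longrightarrow> kappa T * bet (Suc j) \<le> \<alpha> (Suc j)" and "\<And>j. j < K \<Longrightarrow> center j \<in> Y"
  shows "real K * (real K + 1) / 2 * (f (x_tilde K) - f x_opt)
    \<le> kappa T * L * (norm (x_opt - x))\<^sup>2 + total_noise K"
proof -
  have "real K * (real K + 1) / 2 * (f (x_tilde K) - f x_opt)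
      + kappa T * L * (norm (x_opt - x_bar K))\<^sup>2
    \<le> kappa T * L * (norm (x_opt - x))\<^sup>2 + total_noise K"
    using assms
  proof (induction K)
    \<comment> \<open>The gap has weight 0 at the start, so the initial state counts only through
      its distance to \<open>x_opt\<close>.\<close>
    case 0
    then show ?case
      by (simp add: x_bar_0 total_noise_def)
  next
    case (Suc K)
    have "real (Suc K) = real K + 1" "real (Suc K) + 1 = real K + 2"
      by auto
    moreover have "total_noise (Suc K) = total_noise K
        + (real K + 1) * (real K + 2) / 2 * (\<Sum>t<T. avg_weight T t * step_noise K t)"
      by (simp add: total_noise_def)
    moreover note catalyst_step[OF Suc.prems(1)[of K] Suc.prems(2)[of K]] Suc.IH Suc.prems
    ultimately show ?case
      by (smt (verit, best) lessI less_Suc_eq)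
  qed
  moreover have "0 \<le> kappa T * L * (norm (x_opt - x_bar K))\<^sup>2"
    using kappa_pos[OF T] L_pos by simp
  ultimately show ?thesis by linarith
qed

end

end

end

subsection \<open>Sampling errors conditioned on the past\<close>

lemma dual_norm_eq_norm: "dual_norm y = norm (y :: 'a::euclidean_space)"
proof (rule antisym)
  show "dual_norm y \<le> norm y"
    by (rule onorm_bound) (auto simp: Cauchy_Schwarz_ineq2)
  show "norm y \<le> dual_norm y"
    using onorm[OF bounded_linear_inner_right[of y], of y]
    by (cases "y = 0") (auto simp: dot_square_norm power2_eq_square onorm_zero)
qed

lemma power2_norm_add_le:
  fixes x y :: "'a::real_inner"
  shows "(norm (x + y))\<^sup>2 \<le> 2 * (norm x)\<^sup>2 + 2 * (norm y)\<^sup>2"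
proof -
  have "0 \<le> (norm (x - y))\<^sup>2" by simp
  then show ?thesis
    by (simp add: power2_norm_eq_inner inner_add inner_diff inner_commute)
qed

lemma abs_inner_le_power2_norm:
  fixes x y :: "'a::real_inner"
  shows "\<bar>x \<bullet> y\<bar> \<le> (norm x)\<^sup>2 + (norm y)\<^sup>2"
proof -
  have "\<bar>x \<bullet> y\<bar> \<le> norm x * norm y"
    by (rule Cauchy_Schwarz_ineq2)
  moreover have "2 * (norm x * norm y) \<le> (norm x)\<^sup>2 + (norm y)\<^sup>2"
    using sum_squares_bound[of "norm x" "norm y"] by simp
  ultimately show ?thesis
    using mult_nonneg_nonneg[of "norm x" "norm y"] by linarith
qed

locale iid_stream = prob_space M for M :: "'w measure" +
  fixes P :: "'s measure" and \<xi> :: "nat \<Rightarrow> 'w \<Rightarrow> 's"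
  assumes indep_\<xi>: "indep_vars (\<lambda>_. P) \<xi> UNIV"
    and distr_\<xi>: "\<And>n. distr M P (\<xi> n) = P"
begin

lemma measurable_\<xi>: "\<xi> n \<in> measurable M P"
  using indep_\<xi> by (simp add: indep_vars_def)

sublocale P: prob_space P
  using prob_space_distr[OF measurable_\<xi>[of 0]] by (simp add: distr_\<xi>)

text \<open>The \<open>\<sigma>\<close>-algebra generated by the first \<open>n\<close> samples (its measure is irrelevant).\<close>

definition past :: "nat \<Rightarrow> 'w measure"
  where "past n = vimage_algebra (space M) (\<lambda>\<omega>. restrict (\<lambda>i. \<xi> i \<omega>) {..<n}) (PiM {..<n} (\<lambda>_. P))"

lemma space_past [simp]: "space (past n) = space M"
  by (simp add: past_def)

lemma restrict_\<xi>_in_space: "(\<lambda>\<omega>. restrict (\<lambda>i. \<xi> i \<omega>) {..<n}) \<in> space M \<rightarrow> space (PiM {..<n} (\<lambda>_. P))"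
  using measurable_space[OF measurable_\<xi>] by (auto simp: space_PiM)

lemma measurable_pastD:
  assumes "Z \<in> measurable (past n) N"
  shows "Z \<in> measurable M N"
proof -
  have "(\<lambda>\<omega>. \<omega>) \<in> measurable M (past n)"
    unfolding past_def
    by (intro measurable_vimage_algebra2) (auto intro!: measurable_restrict measurable_\<xi>)
  from measurable_compose[OF this assms] show ?thesis .
qed

lemma measurable_past_\<xi>: "i < n \<Longrightarrow> \<xi> i \<in> measurable (past n) P"
  using measurable_compose[OF measurable_vimage_algebra1[OF restrict_\<xi>_in_space]
      measurable_component_singleton[of i "{..<n}" "\<lambda>_. P"]]
  by (simp add: past_def)

lemma measurable_past_mono:
  assumes "Z \<in> measurable (past m) N" "m \<le> n"
  shows "Z \<in> measurable (past n) N"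
proof -
  have "(\<lambda>\<omega>. \<omega>) \<in> measurable (past n) (past m)"
    unfolding past_def[of m]
    using assms(2) by (intro measurable_vimage_algebra2) (auto intro!: measurable_restrict measurable_past_\<xi>)
  from measurable_compose[OF this assms(1)] show ?thesis .
qed

text \<open>Independence of the index blocks {..<n} and {n}, with an event of a single sample
  rewritten as an event of a one-element block.\<close>

lemma prob_past_Int_\<xi>:
  assumes A: "A \<in> sets (past n)" and B: "B \<in> sets P"
  shows "prob (A \<inter> (\<xi> n -` B \<inter> space M)) = prob A * prob (\<xi> n -` B \<inter> space M)"
proof -
  let ?r = "\<lambda>I \<omega>. restrict (\<lambda>i. \<xi> i \<omega>) I" and ?Q = "\<lambda>I. PiM I (\<lambda>_. P)"
  have "indep_var (?Q {..<n}) (?r {..<n}) (?Q {n}) (?r {n})"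
    by (rule indep_var_restrict[OF indep_\<xi>]) auto
  then have indep: "indep_set (sigma_sets (space M) {?r {..<n} -` A \<inter> space M | A. A \<in> sets (?Q {..<n})})
      (sigma_sets (space M) {?r {n} -` A \<inter> space M | A. A \<in> sets (?Q {n})})"
    by (simp add: indep_var_eq)
  have 1: "A \<in> sigma_sets (space M) {?r {..<n} -` A \<inter> space M | A. A \<in> sets (?Q {..<n})}"
    using A by (simp add: past_def sets_vimage_algebra)
  have "(\<lambda>g. g n) -` B \<inter> space (?Q {n}) \<in> sets (?Q {n})"
    by (rule measurable_sets[OF measurable_component_singleton[of n "{n}" "\<lambda>_. P"] B]) simp
  moreover have "\<xi> n -` B \<inter> space M = ?r {n} -` ((\<lambda>g. g n) -` B \<inter> space (?Q {n})) \<inter> space M"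
    using measurable_space[OF measurable_\<xi>] by (auto simp: space_PiM)
  ultimately have 2: "\<xi> n -` B \<inter> space M \<in> sigma_sets (space M) {?r {n} -` A \<inter> space M | A. A \<in> sets (?Q {n})}"
    by (intro sigma_sets.Basic) blast
  show ?thesis
    by (rule indep_setD[OF indep 1 2])
qed

text \<open>Equality of measures is checked on rectangles, where it is the independence just shown.
  It turns an expectation over a past variable and a fresh sample into an iterated integral.\<close>

lemma distr_past_\<xi>:
  assumes Z: "Z \<in> measurable (past n) N"
  shows "distr M (N \<Otimes>\<^sub>M P) (\<lambda>\<omega>. (Z \<omega>, \<xi> n \<omega>)) = distr M N Z \<Otimes>\<^sub>M P"
proof (rule pair_measure_eqI[symmetric])
  note ZM = measurable_pastD[OF Z]
  interpret DZ: prob_space "distr M N Z"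
    by (rule prob_space_distr[OF ZM])
  show "sigma_finite_measure (distr M N Z)" "sigma_finite_measure P" by unfold_locales
  show "sets (distr M N Z \<Otimes>\<^sub>M P) = sets (distr M (N \<Otimes>\<^sub>M P) (\<lambda>\<omega>. (Z \<omega>, \<xi> n \<omega>)))"
    by (simp cong: sets_pair_measure_cong)
  fix A B assume "A \<in> sets (distr M N Z)" and B: "B \<in> sets P"
  then have A: "A \<in> sets N" by simp
  have "emeasure P B = emeasure (distr M P (\<xi> n)) B"
    by (simp only: distr_\<xi>)
  also have "\<dots> = prob (\<xi> n -` B \<inter> space M)"
    using B measurable_\<xi> by (simp add: emeasure_distr emeasure_eq_measure)
  finally have "emeasure (distr M N Z) A * emeasure P B
      = ennreal (prob (Z -` A \<inter> space M) * prob (\<xi> n -` B \<inter> space M))"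
    using A ZM by (simp add: emeasure_distr emeasure_eq_measure ennreal_mult)
  also have "prob (Z -` A \<inter> space M) * prob (\<xi> n -` B \<inter> space M)
      = prob ((Z -` A \<inter> space M) \<inter> (\<xi> n -` B \<inter> space M))"
    using measurable_sets[OF Z A] B by (intro prob_past_Int_\<xi>[symmetric]) auto
  also have "(Z -` A \<inter> space M) \<inter> (\<xi> n -` B \<inter> space M) = (\<lambda>\<omega>. (Z \<omega>, \<xi> n \<omega>)) -` (A \<times> B) \<inter> space M"
    by auto
  finally show "emeasure (distr M N Z) A * emeasure P B
      = emeasure (distr M (N \<Otimes>\<^sub>M P) (\<lambda>\<omega>. (Z \<omega>, \<xi> n \<omega>))) (A \<times> B)"
    using A B measurable_Pair[OF ZM measurable_\<xi>] by (simp add: emeasure_distr emeasure_eq_measure)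
qed

text \<open>The class in which all iterates live: adapted to the samples and square integrable.
  Measurability refers to \<open>past n\<close>, but the integral is taken over
  \<open>M\<close>.\<close>

definition past_L2 :: "nat \<Rightarrow> ('w \<Rightarrow> 'a::euclidean_space) \<Rightarrow> bool"
  where "past_L2 n Z \<longleftrightarrow> Z \<in> borel_measurable (past n) \<and> integrable M (\<lambda>\<omega>. (norm (Z \<omega>))\<^sup>2)"

lemma past_L2_const: "past_L2 n (\<lambda>_. c)"
  by (simp add: past_L2_def)

text \<open>Equality on the sample space is all that is available for \<open>x_tilde_Suc\<close>,
  which presupposes a starting point in \<open>X\<close>.\<close>

lemma past_L2_cong:
  assumes "\<And>\<omega>. \<omega> \<in> space M \<Longrightarrow> Z \<omega> = V \<omega>"
  shows "past_L2 n Z \<longleftrightarrow> past_L2 n V"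
  using assms measurable_cong[of "past n" Z V borel]
    Bochner_Integration.integrable_cong[of M M "\<lambda>\<omega>. (norm (Z \<omega>))\<^sup>2" "\<lambda>\<omega>. (norm (V \<omega>))\<^sup>2"]
  by (simp add: past_L2_def)

lemma past_L2_mono: "past_L2 m Z \<Longrightarrow> m \<le> n \<Longrightarrow> past_L2 n Z"
  by (auto simp: past_L2_def intro: measurable_past_mono)

lemma past_L2_scaleR: "past_L2 n Z \<Longrightarrow> past_L2 n (\<lambda>\<omega>. a *\<^sub>R Z \<omega>)"
  by (auto simp: past_L2_def power_mult_distrib)

lemma past_L2_add:
  fixes Z V :: "'w \<Rightarrow> 'a::euclidean_space"
  assumes "past_L2 n Z" "past_L2 n V"
  shows "past_L2 n (\<lambda>\<omega>. Z \<omega> + V \<omega>)"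
  unfolding past_L2_def
proof
  show meas: "(\<lambda>\<omega>. Z \<omega> + V \<omega>) \<in> borel_measurable (past n)"
    using assms by (auto simp: past_L2_def)
  show "integrable M (\<lambda>\<omega>. (norm (Z \<omega> + V \<omega>))\<^sup>2)"
  proof (rule Bochner_Integration.integrable_bound)
    show "integrable M (\<lambda>\<omega>. 2 * (norm (Z \<omega>))\<^sup>2 + 2 * (norm (V \<omega>))\<^sup>2)"
      using assms by (auto simp: past_L2_def)
    show "(\<lambda>\<omega>. (norm (Z \<omega> + V \<omega>))\<^sup>2) \<in> borel_measurable M"
      using measurable_pastD[OF meas] by measurable
    show "AE \<omega> in M. norm ((norm (Z \<omega> + V \<omega>))\<^sup>2) \<le> norm (2 * (norm (Z \<omega>))\<^sup>2 + 2 * (norm (V \<omega>))\<^sup>2)"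
      using power2_norm_add_le by (auto intro!: AE_I2)
  qed
qed

lemma past_L2_diff:
  fixes Z V :: "'w \<Rightarrow> 'a::euclidean_space"
  shows "past_L2 n Z \<Longrightarrow> past_L2 n V \<Longrightarrow> past_L2 n (\<lambda>\<omega>. Z \<omega> - V \<omega>)"
  using past_L2_add[of n Z "\<lambda>\<omega>. - 1 *\<^sub>R V \<omega>"] past_L2_scaleR[of n V "- 1"] by simp

lemma past_L2_sum:
  fixes Z :: "nat \<Rightarrow> 'w \<Rightarrow> 'a::euclidean_space"
  shows "(\<And>i. i < k \<Longrightarrow> past_L2 n (Z i)) \<Longrightarrow> past_L2 n (\<lambda>\<omega>. \<Sum>i<k. Z i \<omega>)"
  by (induction k) (auto intro: past_L2_const past_L2_add)

lemma past_L2_integrable_inner: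
  fixes Z V :: "'w \<Rightarrow> 'a::euclidean_space"
  assumes "past_L2 m Z" "past_L2 n V"
  shows "integrable M (\<lambda>\<omega>. Z \<omega> \<bullet> V \<omega>)"
proof (rule Bochner_Integration.integrable_bound)
  show "integrable M (\<lambda>\<omega>. (norm (Z \<omega>))\<^sup>2 + (norm (V \<omega>))\<^sup>2)"
    using assms by (auto simp: past_L2_def)
  show "(\<lambda>\<omega>. Z \<omega> \<bullet> V \<omega>) \<in> borel_measurable M"
    using assms by (auto simp: past_L2_def dest!: measurable_pastD)
  show "AE \<omega> in M. norm (Z \<omega> \<bullet> V \<omega>) \<le> norm ((norm (Z \<omega>))\<^sup>2 + (norm (V \<omega>))\<^sup>2)"
    using abs_inner_le_power2_norm by (auto intro!: AE_I2)
qed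

section \<open>The oracle error at a random query point\<close>

context
  fixes Y :: "'a::euclidean_space set" and grad_f :: "'a \<Rightarrow> 'a" and \<sigma> :: real
    and G :: "'a \<Rightarrow> 's \<Rightarrow> 'a" and U :: "'w \<Rightarrow> 'a" and n :: nat
  assumes sfo: "stochastic_oracle Y grad_f \<sigma> P G"
    and U: "U \<in> borel_measurable (past n)" and U_in_Y: "\<And>\<omega>. \<omega> \<in> space M \<Longrightarrow> U \<omega> \<in> Y"
begin

private abbreviation "R \<equiv> restrict_space borel Y"

lemma oracle_measurable: "(\<lambda>(x, z). G x z) \<in> borel_measurable (R \<Otimes>\<^sub>M P)"
  using sfo by (simp add: stochastic_oracle_def)

text \<open>On \<open>Y\<close> the gradient is the mean of the jointly measurable oracle over the
  sample, and integrals depending on a parameter are measurable in it.\<close>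

lemma grad_measurable: "grad_f \<in> borel_measurable R"
proof -
  have "(\<lambda>x. \<integral>z. G x z \<partial>P) \<in> borel_measurable R"
    using oracle_measurable by (rule P.borel_measurable_lebesgue_integral)
  then show ?thesis
    using sfo by (subst measurable_cong[of _ _ "\<lambda>x. \<integral>z. G x z \<partial>P"])
      (auto simp: stochastic_oracle_def space_restrict_space)
qed

lemma error_measurable: "(\<lambda>(x, z). G x z - grad_f x) \<in> borel_measurable (R \<Otimes>\<^sub>M P)"
  using oracle_measurable measurable_compose[OF measurable_fst grad_measurable, of P]
  unfolding case_prod_beta by (intro borel_measurable_diff)

lemma U_measurable: "U \<in> measurable (past n) R"
  using U U_in_Y by (intro measurable_restrict_space2) auto

lemma oracle_past_measurable: "(\<lambda>\<omega>. G (U \<omega>) (\<xi> n \<omega>)) \<in> borel_measurable (past (Suc n))"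
  using measurable_compose[OF measurable_Pair[OF measurable_past_mono[OF U_measurable, of "Suc n"]
      measurable_past_\<xi>[of n "Suc n"]] oracle_measurable] by simp

lemma grad_past_measurable: "(\<lambda>\<omega>. grad_f (U \<omega>)) \<in> borel_measurable (past n)"
  using measurable_compose[OF U_measurable grad_measurable] .

private definition "D \<omega> = G (U \<omega>) (\<xi> n \<omega>) - grad_f (U \<omega>)"

text \<open>Nonnegative integrals come first because square integrability of the error is a
  consequence of this bound. By Tonelli the inner integral over the sample is at most \<sigma>^2 for
  each fixed query point.\<close>

lemma oracle_error_nn_integral: "(\<integral>\<^sup>+\<omega>. ennreal ((norm (D \<omega>))\<^sup>2) \<partial>M) \<le> ennreal (\<sigma>\<^sup>2)"
proof -
  let ?h = "\<lambda>(x, z). ennreal ((norm (G x z - grad_f x))\<^sup>2)"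
  have h: "?h \<in> borel_measurable (R \<Otimes>\<^sub>M P)"
    using error_measurable by (simp add: case_prod_beta)
  have pair: "(\<lambda>\<omega>. (U \<omega>, \<xi> n \<omega>)) \<in> measurable M (R \<Otimes>\<^sub>M P)"
    using measurable_pastD[OF U_measurable] measurable_\<xi> by (rule measurable_Pair)
  have UM: "U \<in> measurable M R"
    using measurable_pastD[OF U_measurable] .
  interpret DU: prob_space "distr M R U"
    by (rule prob_space_distr[OF UM])
  have "(\<integral>\<^sup>+\<omega>. ennreal ((norm (D \<omega>))\<^sup>2) \<partial>M) = (\<integral>\<^sup>+p. ?h p \<partial>distr M (R \<Otimes>\<^sub>M P) (\<lambda>\<omega>. (U \<omega>, \<xi> n \<omega>)))"
    using h pair by (simp add: nn_integral_distr D_def)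
  also have "\<dots> = (\<integral>\<^sup>+p. ?h p \<partial>(distr M R U \<Otimes>\<^sub>M P))"
    by (simp only: distr_past_\<xi>[OF U_measurable])
  also have "\<dots> = (\<integral>\<^sup>+x. (\<integral>\<^sup>+z. ?h (x, z) \<partial>P) \<partial>distr M R U)"
    using h by (intro P.nn_integral_fst[symmetric]) (simp cong: measurable_cong_sets)
  also have "\<dots> \<le> (\<integral>\<^sup>+x. ennreal (\<sigma>\<^sup>2) \<partial>distr M R U)"
  proof (rule nn_integral_mono)
    fix x assume "x \<in> space (distr M R U)"
    then have x: "x \<in> Y" by (simp add: space_restrict_space)
    have "(\<integral>\<^sup>+z. ?h (x, z) \<partial>P) = ennreal (\<integral>z. (norm (G x z - grad_f x))\<^sup>2 \<partial>P)"
      using sfo x by (auto simp: stochastic_oracle_def dual_norm_eq_norm intro!: nn_integral_eq_integral)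
    also have "\<dots> \<le> ennreal (\<sigma>\<^sup>2)"
      using sfo x by (intro ennreal_leI) (auto simp: stochastic_oracle_def dual_norm_eq_norm)
    finally show "(\<integral>\<^sup>+z. ?h (x, z) \<partial>P) \<le> ennreal (\<sigma>\<^sup>2)" .
  qed
  also have "\<dots> = ennreal (\<sigma>\<^sup>2)"
    using DU.emeasure_space_1 by (simp only: nn_integral_const) simp
  finally show ?thesis .
qed

lemma oracle_error_past_measurable: "D \<in> borel_measurable (past (Suc n))"
  using oracle_past_measurable measurable_past_mono[OF grad_past_measurable, of "Suc n"]
  unfolding D_def by simp

lemma oracle_error_past_L2: "past_L2 (Suc n) (\<lambda>\<omega>. G (U \<omega>) (\<xi> n \<omega>) - grad_f (U \<omega>))"
proof -
  have "integrable M (\<lambda>\<omega>. (norm (D \<omega>))\<^sup>2)"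
  proof (rule integrableI_bounded)
    show "(\<lambda>\<omega>. (norm (D \<omega>))\<^sup>2) \<in> borel_measurable M"
      using measurable_pastD[OF oracle_error_past_measurable] by measurable
    show "(\<integral>\<^sup>+\<omega>. ennreal (norm ((norm (D \<omega>))\<^sup>2)) \<partial>M) < \<infinity>"
      using oracle_error_nn_integral by (simp add: le_less_trans)
  qed
  then show ?thesis
    using oracle_error_past_measurable by (simp add: past_L2_def D_def[abs_def])
qed

lemma oracle_error_variance: "(\<integral>\<omega>. (norm (G (U \<omega>) (\<xi> n \<omega>) - grad_f (U \<omega>)))\<^sup>2 \<partial>M) \<le> \<sigma>\<^sup>2"
proof -
  have "ennreal (\<integral>\<omega>. (norm (D \<omega>))\<^sup>2 \<partial>M) = (\<integral>\<^sup>+\<omega>. ennreal ((norm (D \<omega>))\<^sup>2) \<partial>M)"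
    using oracle_error_past_L2 by (intro nn_integral_eq_integral[symmetric]) (auto simp: past_L2_def D_def)
  with oracle_error_nn_integral have "ennreal (\<integral>\<omega>. (norm (D \<omega>))\<^sup>2 \<partial>M) \<le> ennreal (\<sigma>\<^sup>2)"
    by simp
  then show ?thesis
    by (subst (asm) ennreal_le_iff) (simp_all add: D_def)
qed

text \<open>The pair of \<open>U\<close> and \<open>V\<close> is determined by the past, so the
  sample can be averaged with both frozen, and the oracle has zero mean error. Square integrability
  of \<open>V\<close> makes the inner product integrable, as Fubini requires.\<close>

lemma oracle_error_unbiased:
  fixes V :: "'w \<Rightarrow> 'a"
  assumes V: "past_L2 n V"
  shows "(\<integral>\<omega>. (G (U \<omega>) (\<xi> n \<omega>) - grad_f (U \<omega>)) \<bullet> V \<omega> \<partial>M) = 0"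
proof -
  let ?N = "R \<Otimes>\<^sub>M (borel :: 'a measure)"
  let ?Z = "\<lambda>\<omega>. (U \<omega>, V \<omega>)"
  let ?h = "\<lambda>((x, v), z). (G x z - grad_f x) \<bullet> v"
  have Z: "?Z \<in> measurable (past n) ?N"
    using U_measurable V by (auto simp: past_L2_def)
  have "(\<lambda>p. (fst (fst p), snd p)) \<in> measurable (?N \<Otimes>\<^sub>M P) (R \<Otimes>\<^sub>M P)"
    by measurable
  from measurable_compose[OF this error_measurable]
  have "(\<lambda>p. G (fst (fst p)) (snd p) - grad_f (fst (fst p))) \<in> borel_measurable (?N \<Otimes>\<^sub>M P)"
    by (simp add: case_prod_beta)
  then have h: "?h \<in> borel_measurable (?N \<Otimes>\<^sub>M P)"
    unfolding case_prod_beta by measurable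
  have pair: "(\<lambda>\<omega>. (?Z \<omega>, \<xi> n \<omega>)) \<in> measurable M (?N \<Otimes>\<^sub>M P)"
    using measurable_pastD[OF Z] measurable_\<xi> by (rule measurable_Pair)
  interpret DZ: prob_space "distr M ?N ?Z"
    by (rule prob_space_distr[OF measurable_pastD[OF Z]])
  interpret pair_sigma_finite "distr M ?N ?Z" P ..
  have "integrable M (\<lambda>\<omega>. D \<omega> \<bullet> V \<omega>)"
    using past_L2_integrable_inner[OF oracle_error_past_L2 V] by (simp add: D_def)
  then have "integrable (distr M (?N \<Otimes>\<^sub>M P) (\<lambda>\<omega>. (?Z \<omega>, \<xi> n \<omega>))) ?h"
    using h pair by (simp add: integrable_distr_eq D_def)
  then have int: "integrable (distr M ?N ?Z \<Otimes>\<^sub>M P) ?h"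
    by (simp only: distr_past_\<xi>[OF Z])
  have "(\<integral>\<omega>. D \<omega> \<bullet> V \<omega> \<partial>M) = (\<integral>p. ?h p \<partial>distr M (?N \<Otimes>\<^sub>M P) (\<lambda>\<omega>. (?Z \<omega>, \<xi> n \<omega>)))"
    using h pair by (simp add: integral_distr D_def)
  also have "\<dots> = (\<integral>p. ?h p \<partial>(distr M ?N ?Z \<Otimes>\<^sub>M P))"
    by (simp only: distr_past_\<xi>[OF Z])
  also have "\<dots> = (\<integral>p. (\<integral>z. ?h (p, z) \<partial>P) \<partial>distr M ?N ?Z)"
    using int by (rule integral_fst'[symmetric])
  also have "\<dots> = (\<integral>p. 0 \<partial>distr M ?N ?Z)"
  proof (rule Bochner_Integration.integral_cong)
    fix p assume "p \<in> space (distr M ?N ?Z)"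
    then have x: "fst p \<in> Y" by (auto simp: space_pair_measure space_restrict_space)
    have "(\<integral>z. (G (fst p) z - grad_f (fst p)) \<bullet> snd p \<partial>P) = 0"
      using sfo x by (auto simp: stochastic_oracle_def P.prob_space)
    then show "(\<integral>z. ?h (p, z) \<partial>P) = 0"
      by (simp add: case_prod_beta)
  qed simp
  finally show ?thesis
    by (simp add: D_def)
qed

end

end

subsection \<open>Expected progress\<close>

text \<open>Continuity on \<open>Y\<close> gives measurability of \<open>f\<close> along random
  iterates; the final theorem obtains it from \<open>gradient_on\<close>.\<close>

locale stochastic_problem =
  smooth_strongly_convex_problem X Y f grad_f \<mu> L x_opt G + iid_stream M P \<xi>
  for X Y :: "'a::euclidean_space set" and f grad_f \<mu> L x_opt
    and G :: "'a \<Rightarrow> 's \<Rightarrow> 'a" and M :: "'w measure" and P :: "'s measure" and \<xi> +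
  fixes \<sigma> :: real
  assumes sfo: "stochastic_oracle Y grad_f \<sigma> P G"
    and continuous_f: "continuous_on Y f"
begin

lemma f_measurable:
  assumes "Z \<in> borel_measurable M" "\<And>\<omega>. \<omega> \<in> space M \<Longrightarrow> Z \<omega> \<in> X"
  shows "(\<lambda>\<omega>. f (Z \<omega>)) \<in> borel_measurable M"
proof -
  have "Z \<in> measurable M (restrict_space borel Y)"
    using assms X_subset_Y by (intro measurable_restrict_space2) auto
  from measurable_compose[OF this borel_measurable_continuous_on_restrict[OF continuous_f]]
  show ?thesis .
qed

text \<open>The gap is nonnegative on \<open>X\<close>, so an integrable upper bound also controls
  its absolute value.\<close>

lemma integrable_gap_bound:
  assumes Z: "Z \<in> borel_measurable M" "\<And>\<omega>. \<omega> \<in> space M \<Longrightarrow> Z \<omega> \<in> X"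
    and h: "integrable M h" "\<And>\<omega>. \<omega> \<in> space M \<Longrightarrow> f (Z \<omega>) - f x_opt \<le> h \<omega>"
  shows "integrable M (\<lambda>\<omega>. f (Z \<omega>) - f x_opt)"
proof (rule Bochner_Integration.integrable_bound[OF h(1)])
  show "(\<lambda>\<omega>. f (Z \<omega>) - f x_opt) \<in> borel_measurable M"
    using f_measurable[OF Z] by simp
  show "AE \<omega> in M. norm (f (Z \<omega>) - f x_opt) \<le> norm (h \<omega>)"
    using opt_le[OF Z(2)] h(2) by (intro AE_I2) fastforce
qed

context
  fixes x :: "'w \<Rightarrow> 'a" and n :: nat and \<alpha> :: "nat \<Rightarrow> real" and T K :: nat
  assumes T: "0 < T" and x_in_X: "\<And>\<omega>. \<omega> \<in> space M \<Longrightarrow> x \<omega> \<in> X" and x_L2: "past_L2 n x"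
    and center_in_Y: "\<And>\<omega> j. \<omega> \<in> space M \<Longrightarrow> j < K \<Longrightarrow> center (\<lambda>i. \<xi> i \<omega>) \<alpha> T (x \<omega>) n j \<in> Y"
begin

private abbreviation "x_bar' j \<omega> \<equiv> x_bar (\<lambda>i. \<xi> i \<omega>) \<alpha> T (x \<omega>) n j"
private abbreviation "x_tilde' j \<omega> \<equiv> x_tilde (\<lambda>i. \<xi> i \<omega>) \<alpha> T (x \<omega>) n j"
private abbreviation "center' j \<omega> \<equiv> center (\<lambda>i. \<xi> i \<omega>) \<alpha> T (x \<omega>) n j"
private abbreviation "anchor' j \<omega> \<equiv> anchor (\<lambda>i. \<xi> i \<omega>) \<alpha> T (x \<omega>) n j"
private abbreviation "inner' j t \<omega> \<equiv> inner_iterate (\<lambda>i. \<xi> i \<omega>) \<alpha> T (x \<omega>) n j t"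
private abbreviation "error' j t \<omega> \<equiv> step_error (\<lambda>i. \<xi> i \<omega>) \<alpha> T (x \<omega>) n j t"
private abbreviation "noise' j t \<omega> \<equiv> step_noise (\<lambda>i. \<xi> i \<omega>) \<alpha> T (x \<omega>) n j t"

lemma inner_in_Y: "j < K \<Longrightarrow> \<omega> \<in> space M \<Longrightarrow> inner' j t \<omega> \<in> Y"
  by (intro inner_iterate_in_Y T x_in_X center_in_Y)

lemma step_error_past_L2:
  assumes "j < K" "past_L2 (n + j * T + t) (inner' j t)"
  shows "past_L2 (n + j * T + Suc t) (error' j t)"
    and "(\<integral>\<omega>. (norm (error' j t \<omega>))\<^sup>2 \<partial>M) \<le> \<sigma>\<^sup>2"
    and "past_L2 (n + j * T + t) V \<Longrightarrow> (\<integral>\<omega>. error' j t \<omega> \<bullet> V \<omega> \<partial>M) = 0"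
proof -
  have U: "inner' j t \<in> borel_measurable (past (n + j * T + t))"
    using assms(2) by (simp add: past_L2_def)
  note U' = sfo U inner_in_Y[OF assms(1)]
  show "past_L2 (n + j * T + Suc t) (error' j t)"
    using oracle_error_past_L2[OF U'] by (simp add: step_error_def oracle_error_def)
  show "(\<integral>\<omega>. (norm (error' j t \<omega>))\<^sup>2 \<partial>M) \<le> \<sigma>\<^sup>2"
    using oracle_error_variance[OF U'] by (simp add: step_error_def oracle_error_def)
  show "(\<integral>\<omega>. error' j t \<omega> \<bullet> V \<omega> \<partial>M) = 0" if "past_L2 (n + j * T + t) V"
    using oracle_error_unbiased[OF U' that] by (simp add: step_error_def oracle_error_def)
qed

text \<open>Measurability passes through the step because the projection is continuous. The second
  moment is dominated by \<open>inner_iterate_dist_opt\<close>, whose cross term is an inner product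
  of two square integrable variables.\<close>

lemma inner_past_L2:
  assumes j: "j < K" and c: "past_L2 (n + j * T) (center' j)"
  shows "past_L2 (n + j * T + t) (inner' j t)"
proof (induction t)
  case 0
  then show ?case
    using c by (simp add: inner_iterate_0)
next
  case (Suc t)
  let ?m = "n + j * T + t"
  have U: "inner' j t \<in> borel_measurable (past ?m)"
    using Suc by (simp add: past_L2_def)
  have G: "(\<lambda>\<omega>. G (inner' j t \<omega>) (\<xi> ?m \<omega>)) \<in> borel_measurable (past (Suc ?m))"
    using oracle_past_measurable[OF sfo U inner_in_Y[OF j]] by simp
  have U': "inner' j t \<in> borel_measurable (past (Suc ?m))"
    by (rule measurable_past_mono[OF U]) simp
  have c': "center' j \<in> borel_measurable (past (Suc ?m))"
    using c by (auto simp: past_L2_def intro: measurable_past_mono)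
  have cp: "closest_point X \<in> borel_measurable borel"
    by (intro borel_measurable_continuous_onI continuous_on_closest_point convex_X closed_X X_nonempty)
  have meas: "inner' j (Suc t) \<in> borel_measurable (past (n + j * T + Suc t))"
    unfolding inner_iterate_Suc using U' c' G
    by (intro measurable_compose[OF _ cp]) simp
  note error = step_error_past_L2[OF j Suc]
  have int: "integrable M (\<lambda>\<omega>. (norm (x_opt - inner' j t \<omega>))\<^sup>2 + (norm (x_opt - center' j \<omega>))\<^sup>2
      + 4 / (bet (Suc j) * (real t + 9)) * (- (error' j t \<omega> \<bullet> (inner' j t \<omega> - x_opt))
        + (norm (error' j t \<omega>))\<^sup>2 / (bet (Suc j) * (real t + 5))))"
    using past_L2_diff[OF past_L2_const Suc, of x_opt] past_L2_diff[OF past_L2_const c, of x_opt]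
      past_L2_integrable_inner[OF error(1) past_L2_diff[OF Suc past_L2_const, of x_opt]] error(1)
    by (auto simp: past_L2_def intro!: Bochner_Integration.integrable_add integrable_mult_right
        Bochner_Integration.integrable_minus integrable_divide)
  have "integrable M (\<lambda>\<omega>. (norm (x_opt - inner' j (Suc t) \<omega>))\<^sup>2)"
  proof (rule Bochner_Integration.integrable_bound[OF int])
    show "(\<lambda>\<omega>. (norm (x_opt - inner' j (Suc t) \<omega>))\<^sup>2) \<in> borel_measurable M"
      using measurable_pastD[OF meas] by measurable
    show "AE \<omega> in M. norm ((norm (x_opt - inner' j (Suc t) \<omega>))\<^sup>2)
      \<le> norm ((norm (x_opt - inner' j t \<omega>))\<^sup>2 + (norm (x_opt - center' j \<omega>))\<^sup>2
      + 4 / (bet (Suc j) * (real t + 9)) * (- (error' j t \<omega> \<bullet> (inner' j t \<omega> - x_opt))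
        + (norm (error' j t \<omega>))\<^sup>2 / (bet (Suc j) * (real t + 5))))"
      using inner_iterate_dist_opt[OF T x_in_X center_in_Y] j
      by (intro AE_I2) (simp add: order_trans[OF _ abs_ge_self])
  qed
  then have "past_L2 (n + j * T + Suc t) (\<lambda>\<omega>. x_opt - inner' j (Suc t) \<omega>)"
    using meas by (simp add: past_L2_def)
  from past_L2_diff[OF past_L2_const this, of x_opt] show ?case
    by simp
qed

lemma catalyst_past_L2: "j \<le> K \<Longrightarrow> past_L2 (n + j * T) (x_bar' j) \<and> past_L2 (n + j * T) (x_tilde' j)"
proof (induction j)
  case 0
  then show ?case
    using x_L2 by (simp add: x_bar_0 x_tilde_0)
next
  case (Suc j)
  then have j: "j < K" and IH: "past_L2 (n + j * T) (x_bar' j)" "past_L2 (n + j * T) (x_tilde' j)"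
    by auto
  have "past_L2 (n + j * T) (center' j)"
    unfolding center_eq by (intro past_L2_add past_L2_scaleR IH)
  note inner = inner_past_L2[OF j this]
  have le: "n + j * T + t \<le> n + Suc j * T" if "t \<le> T" for t
    using that by simp
  have "past_L2 (n + Suc j * T) (x_bar' (Suc j))"
    unfolding x_bar_Suc
    by (intro past_L2_add past_L2_scaleR past_L2_mono[OF inner le] past_L2_mono[OF IH(2)]) simp_all
  moreover have "past_L2 (n + Suc j * T) (\<lambda>\<omega>. \<Sum>t<T. avg_weight T t *\<^sub>R inner' j (Suc t) \<omega>)"
    by (intro past_L2_sum past_L2_scaleR past_L2_mono[OF inner le]) simp
  then have "past_L2 (n + Suc j * T) (x_tilde' (Suc j))"
    by (rule past_L2_cong[THEN iffD2, rotated]) (rule x_tilde_Suc[OF T x_in_X])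
  ultimately show ?case by simp
qed

lemma center_past_L2: "j < K \<Longrightarrow> past_L2 (n + j * T) (center' j)"
  unfolding center_eq using catalyst_past_L2[of j] by (intro past_L2_add past_L2_scaleR) auto

lemma step_noise_expectation:
  assumes j: "j < K"
  shows "integrable M (noise' j t)"
    and "(\<integral>\<omega>. noise' j t \<omega> \<partial>M) \<le> \<sigma>\<^sup>2 / (L * (real t + 5))"
proof -
  note U = inner_past_L2[OF j center_past_L2[OF j], of t]
  note error = step_error_past_L2[OF j U]
  have "past_L2 (n + j * T) (anchor' j)"
    unfolding anchor_def using catalyst_past_L2[of j] j
    by (intro past_L2_add past_L2_scaleR past_L2_const) auto
  then have V: "past_L2 (n + j * T + t) (\<lambda>\<omega>. inner' j t \<omega> - anchor' j \<omega>)"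
    by (intro past_L2_diff U) (erule past_L2_mono, simp)
  have int: "integrable M (\<lambda>\<omega>. error' j t \<omega> \<bullet> (inner' j t \<omega> - anchor' j \<omega>))"
    "integrable M (\<lambda>\<omega>. (norm (error' j t \<omega>))\<^sup>2)"
    using past_L2_integrable_inner[OF error(1) V] error(1) by (auto simp: past_L2_def)
  show "integrable M (noise' j t)"
    unfolding step_noise_def using int by auto
  have "(\<integral>\<omega>. noise' j t \<omega> \<partial>M)
      = - (\<integral>\<omega>. error' j t \<omega> \<bullet> (inner' j t \<omega> - anchor' j \<omega>) \<partial>M)
        + (\<integral>\<omega>. (norm (error' j t \<omega>))\<^sup>2 \<partial>M) / (bet (Suc j) * (real t + 5))"
    unfolding step_noise_def using int by simp
  also have "\<dots> = (\<integral>\<omega>. (norm (error' j t \<omega>))\<^sup>2 \<partial>M) / (bet (Suc j) * (real t + 5))"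
    using error(3)[OF V] by simp
  also have "\<dots> \<le> \<sigma>\<^sup>2 / (L * (real t + 5))"
    using L_pos L_le_bet[of j] error(2) by (intro frac_le mult_right_mono mult_pos_pos) auto
  finally show "(\<integral>\<omega>. noise' j t \<omega> \<partial>M) \<le> \<sigma>\<^sup>2 / (L * (real t + 5))" .
qed

text \<open>The growing weight t + 8 offsets the decay 1 / (t + 5) up to the factor 8 / 5, attained
  at t = 0. Each of the \<open>T\<close> summands thus obeys the same bound, and 16 / 5 = 2 * 8 /
  5.\<close>

lemma sum_avg_weight_noise: "(\<Sum>t<T. avg_weight T t * (\<sigma>\<^sup>2 / (L * (real t + 5)))) \<le> 16 / 5 * \<sigma>\<^sup>2 / (L * (real T + 15))"
proof -
  have "avg_weight T t * (\<sigma>\<^sup>2 / (L * (real t + 5))) \<le> 16 / 5 * \<sigma>\<^sup>2 / (L * (real T * (real T + 15)))" for t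
  proof -
    have "(real t + 8) / (real t + 5) \<le> 8 / 5"
      by (simp add: field_simps)
    then have "(real t + 8) / (real t + 5) * (2 * \<sigma>\<^sup>2 / (L * (real T * (real T + 15))))
        \<le> 8 / 5 * (2 * \<sigma>\<^sup>2 / (L * (real T * (real T + 15))))"
      using L_pos by (intro mult_right_mono) auto
    moreover have "2 * p / q * (\<sigma>\<^sup>2 / (L * r)) = p / r * (2 * \<sigma>\<^sup>2 / (L * q))"
      "8 / 5 * (2 * \<sigma>\<^sup>2 / (L * q)) = 16 / 5 * \<sigma>\<^sup>2 / (L * q)" for p q r
      by (simp_all add: mult_ac)
    ultimately show ?thesis
      unfolding avg_weight_def by (simp only:)
  qed
  then have "(\<Sum>t<T. avg_weight T t * (\<sigma>\<^sup>2 / (L * (real t + 5))))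
      \<le> (\<Sum>t<T. 16 / 5 * \<sigma>\<^sup>2 / (L * (real T * (real T + 15))))"
    by (intro sum_mono)
  also have "\<dots> = 16 / 5 * \<sigma>\<^sup>2 / (L * (real T + 15))"
    using T by simp
  finally show ?thesis .
qed

lemma total_noise_expectation:
  shows "integrable M (\<lambda>\<omega>. total_noise (\<lambda>i. \<xi> i \<omega>) \<alpha> T (x \<omega>) n K)"
    and "(\<integral>\<omega>. total_noise (\<lambda>i. \<xi> i \<omega>) \<alpha> T (x \<omega>) n K \<partial>M)
      \<le> real K * (real K + 1) * (real K + 2) / 6 * (16 / 5 * \<sigma>\<^sup>2 / (L * (real T + 15)))"
proof -
  note int = step_noise_expectation(1)
  show "integrable M (\<lambda>\<omega>. total_noise (\<lambda>i. \<xi> i \<omega>) \<alpha> T (x \<omega>) n K)"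
    unfolding total_noise_def
    by (intro Bochner_Integration.integrable_sum integrable_mult_right int) simp
  have "(\<integral>\<omega>. total_noise (\<lambda>i. \<xi> i \<omega>) \<alpha> T (x \<omega>) n K \<partial>M)
      = (\<Sum>j<K. (real j + 1) * (real j + 2) / 2 * (\<Sum>t<T. avg_weight T t * (\<integral>\<omega>. noise' j t \<omega> \<partial>M)))"
    unfolding total_noise_def by (simp add: int Bochner_Integration.integral_sum)
  also have "\<dots> \<le> (\<Sum>j<K. (real j + 1) * (real j + 2) / 2 * (16 / 5 * \<sigma>\<^sup>2 / (L * (real T + 15))))"
  proof (intro sum_mono mult_left_mono)
    fix j assume "j \<in> {..<K}"
    then have "(\<Sum>t<T. avg_weight T t * (\<integral>\<omega>. noise' j t \<omega> \<partial>M))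
        \<le> (\<Sum>t<T. avg_weight T t * (\<sigma>\<^sup>2 / (L * (real t + 5))))"
      by (intro sum_mono mult_left_mono avg_weight_nonneg step_noise_expectation(2)) simp
    also note sum_avg_weight_noise
    finally show "(\<Sum>t<T. avg_weight T t * (\<integral>\<omega>. noise' j t \<omega> \<partial>M))
        \<le> 16 / 5 * \<sigma>\<^sup>2 / (L * (real T + 15))" .
  qed simp
  also have "\<dots> = real K * (real K + 1) * (real K + 2) / 6 * (16 / 5 * \<sigma>\<^sup>2 / (L * (real T + 15)))"
    by (simp only: sum_distrib_right[symmetric] sum_triangular)
  finally show "(\<integral>\<omega>. total_noise (\<lambda>i. \<xi> i \<omega>) \<alpha> T (x \<omega>) n K \<partial>M)
      \<le> real K * (real K + 1) * (real K + 2) / 6 * (16 / 5 * \<sigma>\<^sup>2 / (L * (real T + 15)))" .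
qed

lemma catalyst_expectation:
  assumes \<alpha>: "\<And>j. j < K \<Longrightarrow> kappa T * bet (Suc j) \<le> \<alpha> (Suc j)" and K: "0 < K"
    and gap: "integrable M (\<lambda>\<omega>. f (x \<omega>) - f x_opt)"
  shows "integrable M (\<lambda>\<omega>. f (x_tilde' K \<omega>) - f x_opt)"
    and "(\<integral>\<omega>. (f (x_tilde' K \<omega>) - f x_opt) \<partial>M)
      \<le> 4 * kappa T * L / (\<mu> * (real K * (real K + 1))) * (\<integral>\<omega>. (f (x \<omega>) - f x_opt) \<partial>M)
        + (real K + 2) / 3 * (16 / 5 * \<sigma>\<^sup>2 / (L * (real T + 15)))"
proof -
  define w where "w = real K * (real K + 1) / 2"
  have w: "0 < w" unfolding w_def using K by simp
  \<comment> \<open>The distance coefficient \<kappa> L divided by the quadratic growth constant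
    \<mu> / 2.\<close>
  define b where "b = 2 * kappa T * L / \<mu>"
  have b: "0 \<le> b" unfolding b_def using kappa_pos[OF T] L_pos mu_pos by simp
  let ?noise = "\<lambda>\<omega>. total_noise (\<lambda>i. \<xi> i \<omega>) \<alpha> T (x \<omega>) n K"
  let ?h = "\<lambda>\<omega>. (b * (f (x \<omega>) - f x_opt) + ?noise \<omega>) / w"
  have bound: "f (x_tilde' K \<omega>) - f x_opt \<le> ?h \<omega>" if \<omega>: "\<omega> \<in> space M" for \<omega>
  proof -
    have "w * (f (x_tilde' K \<omega>) - f x_opt) \<le> kappa T * L * (norm (x_opt - x \<omega>))\<^sup>2 + ?noise \<omega>"
      unfolding w_def by (rule catalyst_pathwise_bound[OF T x_in_X[OF \<omega>] \<alpha> center_in_Y[OF \<omega>]])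
    also have "kappa T * L * (norm (x_opt - x \<omega>))\<^sup>2 = b * (\<mu> / 2 * (norm (x \<omega> - x_opt))\<^sup>2)"
      unfolding b_def using mu_pos by (simp add: norm_minus_commute)
    also have "\<dots> \<le> b * (f (x \<omega>) - f x_opt)"
      by (intro mult_left_mono quadratic_growth x_in_X \<omega> b)
    finally show ?thesis
      using w by (simp add: pos_le_divide_eq mult.commute)
  qed
  have h: "integrable M ?h"
    using gap total_noise_expectation(1) by auto
  have Z: "x_tilde' K \<in> borel_measurable M"
    using catalyst_past_L2[of K] by (auto simp: past_L2_def dest: measurable_pastD)
  show int: "integrable M (\<lambda>\<omega>. f (x_tilde' K \<omega>) - f x_opt)"
    using integrable_gap_bound[OF Z _ h bound] x_tilde_in_X[OF T x_in_X] by simp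
  have "(\<integral>\<omega>. (f (x_tilde' K \<omega>) - f x_opt) \<partial>M) \<le> (\<integral>\<omega>. ?h \<omega> \<partial>M)"
    using int h bound by (rule integral_mono)
  also have "\<dots> = (b * (\<integral>\<omega>. (f (x \<omega>) - f x_opt) \<partial>M) + (\<integral>\<omega>. ?noise \<omega> \<partial>M)) / w"
    using gap total_noise_expectation(1)
    by (simp only: integral_divide_zero Bochner_Integration.integral_add integral_mult_right_zero integrable_mult_right)
  also have "\<dots> \<le> (b * (\<integral>\<omega>. (f (x \<omega>) - f x_opt) \<partial>M)
      + real K * (real K + 1) * (real K + 2) / 6 * (16 / 5 * \<sigma>\<^sup>2 / (L * (real T + 15)))) / w"
    using total_noise_expectation(2) w by (intro divide_right_mono add_left_mono) auto
  also have "\<dots> = b / w * (\<integral>\<omega>. (f (x \<omega>) - f x_opt) \<partial>M)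
      + real K * (real K + 1) * (real K + 2) / 6 / w * (16 / 5 * \<sigma>\<^sup>2 / (L * (real T + 15)))"
    by (simp only: add_divide_distrib times_divide_eq_left)
  also have "b / w = 4 * kappa T * L / (\<mu> * (real K * (real K + 1)))"
    unfolding b_def w_def by simp
  also have "real K * (real K + 1) * (real K + 2) / 6 / w = (real K + 2) / 3"
  proof -
    have frac: "a * c / 6 / (a / 2) = c / 3" if "a \<noteq> 0" for a c :: real
      using that by simp
    show ?thesis
      unfolding w_def by (rule frac) (use K in simp)
  qed
  finally show "(\<integral>\<omega>. (f (x_tilde' K \<omega>) - f x_opt) \<partial>M)
      \<le> 4 * kappa T * L / (\<mu> * (real K * (real K + 1))) * (\<integral>\<omega>. (f (x \<omega>) - f x_opt) \<partial>M)
        + (real K + 2) / 3 * (16 / 5 * \<sigma>\<^sup>2 / (L * (real T + 15)))" .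
qed

end

end

section \<open>Constants of one epoch and the restart argument\<close>

lemma catalyst_weight_le:
  assumes T: "8 \<le> T" and b: "0 < b"
  shows "kappa T * b \<le> b / (1 - 90 / ((real T + 9) * (real T + 10)))"
proof -
  let ?q = "90 / ((real T + 9) * (real T + 10))"
  have T0: "0 < T" using T by simp
  have pos: "90 < (real T + 9) * (real T + 10)"
    using T0 by (simp add: algebra_simps add_strict_increasing)
  have S: "0 < (real T + 7) * (real T + 8)" "0 < (real T + 9) * (real T + 10)"
    using T0 by (auto intro!: mult_pos_pos add_pos_pos)
  \<comment> \<open>This compares the two values of \<Lambda>. Both would be 1 at T = 0, where
    equality holds; the difference of the two sides is 34 T^2 + 286 T.\<close>
  have "56 * ((real T + 9) * (real T + 10)) \<le> 90 * ((real T + 7) * (real T + 8))"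
    by (simp add: algebra_simps)
  then have "56 / ((real T + 7) * (real T + 8)) \<le> ?q"
    using S by (simp add: divide_le_eq pos_le_divide_eq mult.commute)
  then have le: "1 - ?q \<le> 1 - 56 / ((real T + 7) * (real T + 8))"
    by simp
  have "kappa T * (1 - 56 / ((real T + 7) * (real T + 8))) = kappa T - kappa T * 56 / ((real T + 7) * (real T + 8))"
    by (simp add: right_diff_distrib)
  also have "kappa T * 56 / ((real T + 7) * (real T + 8)) = 56 / (real T * (real T + 15))"
    unfolding kappa_def using S by simp
  finally have 1: "kappa T * (1 - 56 / ((real T + 7) * (real T + 8))) = 1"
    unfolding kappa_eq[OF T0] by simp
  have "kappa T * (1 - ?q) \<le> 1"
    using mult_left_mono[OF le, of "kappa T"] kappa_pos[OF T0] unfolding 1 by simp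
  moreover have "0 < 1 - ?q"
    using pos S by simp
  ultimately have "kappa T \<le> 1 / (1 - ?q)"
    by (simp add: pos_le_divide_eq)
  from mult_right_mono[OF this, of b] show ?thesis
    using b by simp
qed

lemma kappa_le_2: "8 \<le> T \<Longrightarrow> kappa T \<le> 2"
proof -
  assume T: "8 \<le> T"
  then have "8 * (8 + 15) \<le> real T * (real T + 15)"
    by (intro mult_mono) auto
  then show ?thesis
    using T by (simp add: kappa_eq)
qed

text \<open>Here p stands for 2^e, so 2 \<Delta> / p is the bound inherited from the previous epoch.
  K^2 \<ge> 36 L / \<mu> and \<kappa> \<le> 2 give the factor 4 * 2 / 36 = 2 / 9, hence 4 / 9 of the
  target \<Delta> / p. The constant 128 in \<open>T\<close> leaves 16 / 5 / 128 = 1 / 40 of it for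
  the noise, so the sum stays below 1.\<close>

lemma epoch_contraction:
  fixes \<mu> L \<sigma> \<Delta> r p :: real
  assumes \<mu>: "0 < \<mu>" "\<mu> \<le> L" and K: "6 * sqrt (L / \<mu>) \<le> real K" and T: "8 \<le> T"
    and noise: "128 * \<sigma>\<^sup>2 * p * real K / (L * \<Delta>) \<le> real T" and \<Delta>: "0 < \<Delta>" and p: "0 < p" and r: "r \<le> 2 * \<Delta> / p"
  shows "4 * kappa T * L / (\<mu> * (real K * (real K + 1))) * r
        + (real K + 2) / 3 * (16 / 5 * \<sigma>\<^sup>2 / (L * (real T + 15))) \<le> \<Delta> / p"
proof -
  have L: "0 < L" using \<mu> by linarith
  have "1 \<le> sqrt (L / \<mu>)" using \<mu> by simp
  then have K6: "6 \<le> real K" using K by linarith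
  have "(6 * sqrt (L / \<mu>))\<^sup>2 \<le> (real K)\<^sup>2"
    using K \<mu> by (intro power_mono) auto
  then have "36 * (L / \<mu>) \<le> real K * real K"
    using \<mu> L by (simp add: power_mult_distrib power2_eq_square)
  also have "\<dots> \<le> real K * (real K + 1)"
    by (intro mult_left_mono) auto
  finally have KL: "36 * (L / \<mu>) \<le> real K * (real K + 1)" .
  have K0: "0 < K" using K6 by linarith
  then have KK: "0 < real K * (real K + 1)" by simp
  have c: "L / \<mu> / (real K * (real K + 1)) \<le> 1 / 36"
  proof -
    have "y / S \<le> 1 / 36" if "36 * y \<le> S" "0 < S" for y S :: real
      using that by (simp add: field_simps)
    from this[OF KL KK] show ?thesis .
  qed
  have k: "0 < kappa T" "kappa T \<le> 2"
    using T kappa_le_2 by (auto intro: kappa_pos)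
  have "4 * kappa T * L / (\<mu> * (real K * (real K + 1))) = 4 * kappa T * (L / \<mu> / (real K * (real K + 1)))"
    by simp
  also have "\<dots> \<le> 4 * 2 * (1 / 36)"
    using k c L \<mu> by (intro mult_mono) auto
  finally have coeff: "4 * kappa T * L / (\<mu> * (real K * (real K + 1))) \<le> 2 / 9"
    by simp
  have "0 \<le> 4 * kappa T * L / (\<mu> * (real K * (real K + 1)))"
    using k L \<mu> K0 by (intro divide_nonneg_pos mult_nonneg_nonneg mult_pos_pos) auto
  then have "4 * kappa T * L / (\<mu> * (real K * (real K + 1))) * r
      \<le> 4 * kappa T * L / (\<mu> * (real K * (real K + 1))) * (2 * \<Delta> / p)"
    using r by (intro mult_left_mono) auto
  also have "\<dots> \<le> 2 / 9 * (2 * \<Delta> / p)"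
    using coeff \<Delta> p by (intro mult_right_mono) auto
  finally have 1: "4 * kappa T * L / (\<mu> * (real K * (real K + 1))) * r \<le> 4 / 9 * (\<Delta> / p)"
    by simp
  have T0: "0 < real T" using T by simp
  have "128 * (\<sigma>\<^sup>2 * real K) * p \<le> real T * (L * \<Delta>)"
    using noise L \<Delta> by (simp add: divide_le_eq mult_ac)
  then have noise': "\<sigma>\<^sup>2 * real K / (L * real T) \<le> 1 / 128 * (\<Delta> / p)"
    using L T0 p by (simp add: field_simps)
  have "(real K + 2) / 3 * (16 / 5 * \<sigma>\<^sup>2 / (L * (real T + 15))) \<le> real K * (16 / 5 * \<sigma>\<^sup>2 / (L * real T))"
    using K6 T0 L by (intro mult_mono divide_left_mono mult_left_mono mult_pos_pos) auto
  also have "\<dots> = 16 / 5 * (\<sigma>\<^sup>2 * real K / (L * real T))"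
    by simp
  also have "\<dots> \<le> 16 / 5 * (1 / 128 * (\<Delta> / p))"
    using noise' by simp
  finally have 2: "(real K + 2) / 3 * (16 / 5 * \<sigma>\<^sup>2 / (L * (real T + 15))) \<le> 1 / 40 * (\<Delta> / p)"
    by simp
  have "0 \<le> \<Delta> / p" using \<Delta> p by simp
  with 1 2 show ?thesis by linarith
qed

context stochastic_problem
begin

context
  fixes \<alpha> :: "nat \<Rightarrow> nat \<Rightarrow> real" and T :: "nat \<Rightarrow> nat" and K E :: nat and x\<^sub>0 :: 'a
begin

private definition "run s i = r_catalyst X G s \<mu> gam bet eta \<alpha> T K x\<^sub>0 i"
text \<open>The number of calls does not depend on the samples, so every epoch starts at a
  deterministic index and its start can be adapted to the past up to that index.\<close>

private definition "calls i = (\<Sum>e\<in>{1..i}. K * T e)"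

lemma snd_run: "snd (run s i) = calls i"
  by (induction i) (simp_all add: run_def calls_def catalyst_eq case_prod_beta Let_def)

lemma r_catalyst_calls: "snd (r_catalyst X G s \<mu> gam bet eta \<alpha> T K x\<^sub>0 i) = (\<Sum>e\<in>{1..i}. K * T e)"
  using snd_run unfolding run_def calls_def .

lemma fst_run_Suc:
  "fst (run s (Suc i)) = x_tilde s (\<alpha> (Suc i)) (T (Suc i)) (fst (run s i)) (calls i) K"
  using snd_run[of s i] by (simp add: run_def catalyst_eq case_prod_beta Let_def)

lemma r_catalyst_center_eq:
  "r_catalyst_center X G s \<mu> gam bet eta \<alpha> T K x\<^sub>0 (Suc i) (Suc j)
    = center s (\<alpha> (Suc i)) (T (Suc i)) (fst (run s i)) (calls i) j"
  using snd_run[of s i]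
  by (simp add: r_catalyst_center_def run_def catalyst_eq case_prod_beta Let_def center_def)

text \<open>The first three conjuncts are what \<open>catalyst_expectation\<close> demands of a
  random starting point; they accompany the gap bound so that the induction can restart Catalyst at
  the output of an epoch.\<close>

lemma r_catalyst_expectation:
  assumes x0: "x\<^sub>0 \<in> X" "x\<^sub>0 \<noteq> x_opt"
    and \<Delta>: "\<Delta> = f x\<^sub>0 - f x_opt" "0 < \<Delta>"
    and K: "6 * sqrt (L / \<mu>) \<le> real K"
    and T: "\<And>e. 8 + 128 * \<sigma>\<^sup>2 * 2 ^ e * real K / (L * \<Delta>) \<le> real (T e)"
    and \<alpha>: "\<And>e k. \<alpha> e k = bet k / (1 - 90 / ((real (T e) + 9) * (real (T e) + 10)))"
    and centers: "\<And>\<omega> e k. \<omega> \<in> space M \<Longrightarrow> e \<in> {1..E} \<Longrightarrow> k \<in> {1..K} \<Longrightarrow>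
      r_catalyst_center X G (\<lambda>i. \<xi> i \<omega>) \<mu> gam bet eta \<alpha> T K x\<^sub>0 e k \<in> Y"
    and i: "i \<le> E"
  shows "(\<forall>\<omega>\<in>space M. fst (run (\<lambda>i. \<xi> i \<omega>) i) \<in> X) \<and>
    past_L2 (calls i) (\<lambda>\<omega>. fst (run (\<lambda>i. \<xi> i \<omega>) i)) \<and>
    integrable M (\<lambda>\<omega>. f (fst (run (\<lambda>i. \<xi> i \<omega>) i)) - f x_opt) \<and>
    (\<integral>\<omega>. (f (fst (run (\<lambda>i. \<xi> i \<omega>) i)) - f x_opt) \<partial>M) \<le> \<Delta> / 2 ^ i"
  using i
proof (induction i)
  case 0
  then show ?case
    using x0 \<Delta> by (simp add: run_def past_L2_const prob_space)
next
  case (Suc i)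
  let ?x = "\<lambda>\<omega>. fst (run (\<lambda>i. \<xi> i \<omega>) i)" and ?T = "T (Suc i)" and ?\<alpha> = "\<alpha> (Suc i)"
  have x: "\<And>\<omega>. \<omega> \<in> space M \<Longrightarrow> ?x \<omega> \<in> X" and L2: "past_L2 (calls i) ?x"
    and gap: "integrable M (\<lambda>\<omega>. f (?x \<omega>) - f x_opt)"
    and gap_le: "(\<integral>\<omega>. (f (?x \<omega>) - f x_opt) \<partial>M) \<le> \<Delta> / 2 ^ i"
    using Suc by auto
  have \<mu>L: "\<mu> \<le> L"
    by (rule modulus_le_smoothness[OF x0])
  have "0 \<le> 128 * \<sigma>\<^sup>2 * 2 ^ Suc i * real K / (L * \<Delta>)"
    using L_pos \<Delta> by simp
  then have T8: "8 \<le> ?T" and noise: "128 * \<sigma>\<^sup>2 * 2 ^ Suc i * real K / (L * \<Delta>) \<le> real ?T"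
    using T[of "Suc i"] by linarith+
  have "1 \<le> sqrt (L / \<mu>)" using \<mu>L mu_pos by simp
  then have K0: "0 < K" using K by linarith
  have T0: "0 < ?T" using T8 by simp
  have c: "center (\<lambda>i. \<xi> i \<omega>) ?\<alpha> ?T (?x \<omega>) (calls i) j \<in> Y" if "\<omega> \<in> space M" "j < K" for \<omega> j
    using centers[OF that(1), of "Suc i" "Suc j"] Suc.prems that(2) by (simp add: r_catalyst_center_eq)
  have a: "kappa ?T * bet (Suc j) \<le> ?\<alpha> (Suc j)" for j
    unfolding \<alpha> by (rule catalyst_weight_le[OF T8 bet_pos])
  note exp = catalyst_expectation[OF T0 x L2 c a K0 gap]
  \<comment> \<open>\<open>epoch_contraction\<close> is used with p = 2^(i + 1), so its hypothesis 2
    \<Delta> / p is the inherited bound \<Delta> / 2^i.\<close>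
  have "(\<integral>\<omega>. (f (x_tilde (\<lambda>i. \<xi> i \<omega>) ?\<alpha> ?T (?x \<omega>) (calls i) K) - f x_opt) \<partial>M) \<le> \<Delta> / 2 ^ Suc i"
    using gap_le by (intro order_trans[OF exp(2)] epoch_contraction mu_pos \<mu>L K T8 noise \<Delta>) simp_all
  moreover have "past_L2 (calls (Suc i)) (\<lambda>\<omega>. x_tilde (\<lambda>i. \<xi> i \<omega>) ?\<alpha> ?T (?x \<omega>) (calls i) K)"
    using catalyst_past_L2[OF T0 x L2 c order.refl] by (simp add: calls_def)
  ultimately show ?case
    using exp(1) x_tilde_in_X[OF T0 x] by (simp add: fst_run_Suc)
qed

lemmas r_catalyst_gap = r_catalyst_expectation[unfolded run_def]

end

end

section \<open>Counting oracle calls\<close>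

lemma sum_inner_steps_le:
  fixes a :: real and T :: "nat \<Rightarrow> nat"
  assumes "\<And>e. real (T e) \<le> 9 + a * 2 ^ e" "0 \<le> a"
  shows "real (\<Sum>e\<in>{1..i}. K * T e) \<le> real K * (9 * real i + a * (2 * 2 ^ i))"
proof (induction i)
  case (Suc i)
  have "real K * real (T (Suc i)) \<le> real K * (9 + a * 2 ^ Suc i)"
    by (intro mult_left_mono assms) simp
  with Suc show ?case
    by (simp add: algebra_simps)
qed (use assms(2) in simp)

text \<open>The noise part of \<open>T\<close> doubles with each epoch, so its sum is of the order
  of the last term. There K^2 \<le> 49 L / \<mu> cancels L and 2^E \<le> 2 \<Delta> / \<epsilon>
  cancels \<Delta>, leaving \<sigma>^2 / (\<mu> \<epsilon>) with 256 * 49 * 2 = 25088. The constant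
  part contributes 9 * 7 * 2 = 126, and the larger constant serves for both.\<close>

lemma total_calls_le:
  fixes \<mu> L \<sigma> \<Delta> \<epsilon> :: real
  assumes \<mu>: "0 < \<mu>" "\<mu> \<le> L" and \<epsilon>: "0 < \<epsilon>" "\<epsilon> < \<Delta>"
    and K: "real K \<le> 6 * sqrt (L / \<mu>) + 1"
    and T: "\<And>e. real (T e) \<le> 9 + 128 * \<sigma>\<^sup>2 * 2 ^ e * real K / (L * \<Delta>)"
    and E: "real E \<le> log 2 (\<Delta> / \<epsilon>) + 1"
  shows "real (\<Sum>e\<in>{1..E}. K * T e)
    \<le> 25088 * (sqrt (L / \<mu>) * max 1 (log 2 (\<Delta> / \<epsilon>)) + \<sigma>\<^sup>2 / (\<mu> * \<epsilon>))"
proof -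
  define q where "q = sqrt (L / \<mu>)"
  define m where "m = max 1 (log 2 (\<Delta> / \<epsilon>))"
  have L: "0 < L" and \<Delta>: "0 < \<Delta>" using \<mu> \<epsilon> by linarith+
  have q: "1 \<le> q" "q\<^sup>2 = L / \<mu>"
    unfolding q_def using \<mu> L by simp_all
  have K': "real K \<le> 7 * q" using K q(1) unfolding q_def by linarith
  have Em: "real E \<le> 2 * m" unfolding m_def using E by linarith
  have "(2::real) ^ E = 2 powr real E"
    by (simp add: powr_realpow)
  also have "\<dots> \<le> 2 powr (log 2 (\<Delta> / \<epsilon>) + 1)"
    using E by (intro powr_mono) auto
  also have "\<dots> = 2 * (\<Delta> / \<epsilon>)"
    using \<epsilon> \<Delta> by (simp add: powr_add)
  finally have pE: "(2::real) ^ E \<le> 2 * (\<Delta> / \<epsilon>)" .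
  define a where "a = 128 * \<sigma>\<^sup>2 * real K / (L * \<Delta>)"
  have a: "0 \<le> a" unfolding a_def using L \<Delta> by simp
  have "real (T e) \<le> 9 + a * 2 ^ e" for e
    using T[of e] by (simp add: a_def mult_ac)
  then have "real (\<Sum>e\<in>{1..E}. K * T e) \<le> real K * (9 * real E + a * (2 * 2 ^ E))"
    using a by (rule sum_inner_steps_le)
  also have "\<dots> = 9 * (real K * real E) + 256 * \<sigma>\<^sup>2 / (L * \<Delta>) * ((real K)\<^sup>2 * 2 ^ E)"
    by (simp add: a_def distrib_left power2_eq_square)
  also have "\<dots> \<le> 9 * (7 * q * (2 * m)) + 256 * \<sigma>\<^sup>2 / (L * \<Delta>) * ((7 * q)\<^sup>2 * (2 * (\<Delta> / \<epsilon>)))"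
    using K' Em pE q \<mu> L \<Delta> by (intro add_mono mult_left_mono mult_mono power_mono) auto
  also have "(7 * q)\<^sup>2 = 49 * (L / \<mu>)"
    by (simp add: power_mult_distrib q)
  also have "256 * \<sigma>\<^sup>2 / (L * \<Delta>) * (49 * (L / \<mu>) * (2 * (\<Delta> / \<epsilon>))) = 25088 * (\<sigma>\<^sup>2 / (\<mu> * \<epsilon>))"
    using L \<Delta> by simp
  finally have "real (\<Sum>e\<in>{1..E}. K * T e) \<le> 126 * (q * m) + 25088 * (\<sigma>\<^sup>2 / (\<mu> * \<epsilon>))"
    by simp
  moreover have "0 \<le> q * m"
    unfolding m_def using q by simp
  ultimately show ?thesis
    unfolding m_def q_def by (simp add: algebra_simps)
qed

text \<open>The constant is chosen before all problem data, hence absolute. The real parameters are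
  rounded up to integers; a logarithm strictly between 0 and 1 still costs one epoch, which is why
  the bound contains its maximum with 1.\<close>

theorem theorem2p2:
  shows "\<exists>C>0. \<forall>(X :: 'a::euclidean_space set) Y f grad_f \<mu> L \<sigma> (P :: 's measure) G
      (M :: 'w measure) \<xi> x\<^sub>0 x_opt \<epsilon>.
    problem_setting X Y f grad_f \<mu> L \<sigma> P G \<longrightarrow> iid_samples M P \<xi> \<longrightarrow>
    0 < \<mu> \<longrightarrow> 0 < L \<longrightarrow> 0 < \<epsilon> \<longrightarrow> x\<^sub>0 \<in> X \<longrightarrow> is_arg_min f (\<lambda>x. x \<in> X) x_opt \<longrightarrow>
    (let \<Delta> = f x\<^sub>0 - f x_opt;
         E = nat \<lceil>log 2 (\<Delta> / \<epsilon>)\<rceil>;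
         K = nat \<lceil>6 * sqrt (L / \<mu>)\<rceil>;
         \<gamma> = (\<lambda>k. 2 / (real k + 1));
         \<beta> = (\<lambda>k. (real k + 1) * L / real k);
         T = (\<lambda>e. nat \<lceil>8 + 128 * \<sigma>\<^sup>2 * 2 ^ e * real K / (L * \<Delta>)\<rceil>);
         \<Lambda> = (\<lambda>e. 90 / ((real (T e) + 9) * (real (T e) + 10)));
         \<alpha> = (\<lambda>e k. \<beta> k / (1 - \<Lambda> e));
         \<eta> = (\<lambda>k t. 2 / (\<beta> k * (real t + 8)));
         run = (\<lambda>\<omega>. r_catalyst X G (\<lambda>n. \<xi> n \<omega>) \<mu> \<gamma> \<beta> \<eta> \<alpha> T K x\<^sub>0 E);
         center = (\<lambda>\<omega>. r_catalyst_center X G (\<lambda>n. \<xi> n \<omega>) \<mu> \<gamma> \<beta> \<eta> \<alpha> T K x\<^sub>0)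
     in (\<forall>\<omega>\<in>space M. \<forall>e\<in>{1..E}. \<forall>k\<in>{1..K}. center \<omega> e k \<in> Y) \<longrightarrow>
        integrable M (\<lambda>\<omega>. f (fst (run \<omega>)) - f x_opt) \<and>
        (\<integral>\<omega>. (f (fst (run \<omega>)) - f x_opt) \<partial>M) \<le> \<epsilon> \<and>
        (\<forall>\<omega>\<in>space M. real (snd (run \<omega>))
          \<le> C * (sqrt (L / \<mu>) * max 1 (log 2 (\<Delta> / \<epsilon>)) + \<sigma>\<^sup>2 / (\<mu> * \<epsilon>))))"
proof (intro exI[of _ "25088::real"] conjI allI impI)
  fix X Y :: "'a set" and f grad_f and \<mu> L \<sigma> :: real and P :: "'s measure" and G
    and M :: "'w measure" and \<xi> x\<^sub>0 x_opt and \<epsilon> :: real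
  assume setting: "problem_setting X Y f grad_f \<mu> L \<sigma> P G" and iid: "iid_samples M P \<xi>"
    and \<mu>: "0 < \<mu>" and L: "0 < L" and \<epsilon>: "0 < \<epsilon>" and x0: "x\<^sub>0 \<in> X"
    and opt: "is_arg_min f (\<lambda>x. x \<in> X) x_opt"
  have cont: "continuous_on Y f"
    using setting by (auto simp: problem_setting_def gradient_on_def intro: has_derivative_continuous_on)
  interpret prob_space M
    using iid by (simp add: iid_samples_def)
  interpret stochastic_problem X Y f grad_f \<mu> L x_opt G M P \<xi> \<sigma>
    using setting iid \<mu> L opt cont
    by unfold_locales (auto simp: problem_setting_def iid_samples_def)
  define \<Delta> where "\<Delta> = f x\<^sub>0 - f x_opt"
  define E where "E = nat \<lceil>log 2 (\<Delta> / \<epsilon>)\<rceil>"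
  define K where "K = nat \<lceil>6 * sqrt (L / \<mu>)\<rceil>"
  define T where "T = (\<lambda>e. nat \<lceil>8 + 128 * \<sigma>\<^sup>2 * 2 ^ e * real K / (L * \<Delta>)\<rceil>)"
  define \<alpha> where "\<alpha> = (\<lambda>e k. bet k / (1 - 90 / ((real (T e) + 9) * (real (T e) + 10))))"
  let ?run = "\<lambda>\<omega>. r_catalyst X G (\<lambda>n. \<xi> n \<omega>) \<mu> gam bet eta \<alpha> T K x\<^sub>0 E"
  have \<Delta>0: "0 \<le> \<Delta>"
    unfolding \<Delta>_def using opt_le[OF x0] by simp
  have goal: "integrable M (\<lambda>\<omega>. f (fst (?run \<omega>)) - f x_opt) \<and>
      (\<integral>\<omega>. (f (fst (?run \<omega>)) - f x_opt) \<partial>M) \<le> \<epsilon> \<and>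
      (\<forall>\<omega>\<in>space M. real (snd (?run \<omega>))
        \<le> 25088 * (sqrt (L / \<mu>) * max 1 (log 2 (\<Delta> / \<epsilon>)) + \<sigma>\<^sup>2 / (\<mu> * \<epsilon>)))"
    if centers: "\<forall>\<omega>\<in>space M. \<forall>e\<in>{1..E}. \<forall>k\<in>{1..K}.
      r_catalyst_center X G (\<lambda>n. \<xi> n \<omega>) \<mu> gam bet eta \<alpha> T K x\<^sub>0 e k \<in> Y"
  \<comment> \<open>If \<Delta> \<le> \<epsilon>, the logarithm is at most 0, no epoch is run and
    the output is the starting point. This also covers \<Delta> = 0, where the quotient in
    \<open>T\<close> is a division by zero.\<close>
  proof (cases "\<Delta> \<le> \<epsilon>")
    case True
    then have "log 2 (\<Delta> / \<epsilon>) \<le> 0"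
      using \<Delta>0 \<epsilon> by (cases "\<Delta> = 0") (auto simp: log_def divide_le_0_iff)
    then have "E = 0"
      unfolding E_def by simp
    then show ?thesis
      using True \<mu> L \<epsilon> by (simp add: prob_space \<Delta>_def[symmetric])
  next
    case False
    then have \<Delta>: "\<epsilon> < \<Delta>" "0 < \<Delta>" using \<epsilon> by auto
    have ne: "x\<^sub>0 \<noteq> x_opt"
      using \<Delta>(2) by (auto simp: \<Delta>_def)
    have log0: "0 < log 2 (\<Delta> / \<epsilon>)"
      using \<Delta> \<epsilon> by simp
    have E: "log 2 (\<Delta> / \<epsilon>) \<le> real E" "real E \<le> log 2 (\<Delta> / \<epsilon>) + 1"
      unfolding E_def using log0 by linarith+
    have "0 \<le> 6 * sqrt (L / \<mu>)"
      using \<mu> L by simp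
    then have K: "6 * sqrt (L / \<mu>) \<le> real K" "real K \<le> 6 * sqrt (L / \<mu>) + 1"
      unfolding K_def by linarith+
    have T: "8 + 128 * \<sigma>\<^sup>2 * 2 ^ e * real K / (L * \<Delta>) \<le> real (T e)"
      "real (T e) \<le> 9 + 128 * \<sigma>\<^sup>2 * 2 ^ e * real K / (L * \<Delta>)" for e
    proof -
      have "0 \<le> 128 * \<sigma>\<^sup>2 * 2 ^ e * real K / (L * \<Delta>)"
        using L \<Delta> by simp
      then show "8 + 128 * \<sigma>\<^sup>2 * 2 ^ e * real K / (L * \<Delta>) \<le> real (T e)"
        "real (T e) \<le> 9 + 128 * \<sigma>\<^sup>2 * 2 ^ e * real K / (L * \<Delta>)"
        unfolding T_def by linarith+
    qed
    have "\<Delta> / \<epsilon> = 2 powr (log 2 (\<Delta> / \<epsilon>))"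
      using \<Delta> \<epsilon> by simp
    also have "\<dots> \<le> 2 powr real E"
      using E by (intro powr_mono) auto
    also have "\<dots> = 2 ^ E"
      by (simp add: powr_realpow)
    finally have "\<Delta> / 2 ^ E \<le> \<epsilon>"
      using \<epsilon> by (simp add: divide_le_eq mult.commute)
    moreover have "integrable M (\<lambda>\<omega>. f (fst (?run \<omega>)) - f x_opt) \<and>
        (\<integral>\<omega>. (f (fst (?run \<omega>)) - f x_opt) \<partial>M) \<le> \<Delta> / 2 ^ E"
      using r_catalyst_gap[OF x0 ne \<Delta>_def \<Delta>(2) K(1) T(1), of \<alpha> E E] centers
      by (simp add: \<alpha>_def)
    moreover have "real (snd (?run \<omega>))
        \<le> 25088 * (sqrt (L / \<mu>) * max 1 (log 2 (\<Delta> / \<epsilon>)) + \<sigma>\<^sup>2 / (\<mu> * \<epsilon>))" for \<omega>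
      unfolding r_catalyst_calls
      by (rule total_calls_le[OF \<mu> modulus_le_smoothness[OF x0 ne] \<epsilon> \<Delta>(1) K(2) T(2) E(2)])
    ultimately show ?thesis
      by auto
  qed
  have gam: "gam = (\<lambda>k. 2 / (real k + 1))" and bet: "bet = (\<lambda>k. (real k + 1) * L / real k)"
    and eta: "eta = (\<lambda>k t. 2 / (bet k * (real t + 8)))"
    by (simp_all add: gam_def bet_def eta_def fun_eq_iff)
  from goal show "(let \<Delta> = f x\<^sub>0 - f x_opt;
         E = nat \<lceil>log 2 (\<Delta> / \<epsilon>)\<rceil>;
         K = nat \<lceil>6 * sqrt (L / \<mu>)\<rceil>;
         \<gamma> = (\<lambda>k. 2 / (real k + 1));
         \<beta> = (\<lambda>k. (real k + 1) * L / real k);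
         T = (\<lambda>e. nat \<lceil>8 + 128 * \<sigma>\<^sup>2 * 2 ^ e * real K / (L * \<Delta>)\<rceil>);
         \<Lambda> = (\<lambda>e. 90 / ((real (T e) + 9) * (real (T e) + 10)));
         \<alpha> = (\<lambda>e k. \<beta> k / (1 - \<Lambda> e));
         \<eta> = (\<lambda>k t. 2 / (\<beta> k * (real t + 8)));
         run = (\<lambda>\<omega>. r_catalyst X G (\<lambda>n. \<xi> n \<omega>) \<mu> \<gamma> \<beta> \<eta> \<alpha> T K x\<^sub>0 E);
         center = (\<lambda>\<omega>. r_catalyst_center X G (\<lambda>n. \<xi> n \<omega>) \<mu> \<gamma> \<beta> \<eta> \<alpha> T K x\<^sub>0)
     in (\<forall>\<omega>\<in>space M. \<forall>e\<in>{1..E}. \<forall>k\<in>{1..K}. center \<omega> e k \<in> Y) \<longrightarrow>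
        integrable M (\<lambda>\<omega>. f (fst (run \<omega>)) - f x_opt) \<and>
        (\<integral>\<omega>. (f (fst (run \<omega>)) - f x_opt) \<partial>M) \<le> \<epsilon> \<and>
        (\<forall>\<omega>\<in>space M. real (snd (run \<omega>))
          \<le> 25088 * (sqrt (L / \<mu>) * max 1 (log 2 (\<Delta> / \<epsilon>)) + \<sigma>\<^sup>2 / (\<mu> * \<epsilon>))))"
    unfolding Let_def \<alpha>_def T_def E_def K_def \<Delta>_def gam eta bet by (rule impI)
qed simp

end
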